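(* For every $a>1$, $\mathcal C_a(0)=0$, $\mathcal C_a'(0)=0$, and $$\mathcal C_a''(0)=\frac1{\pi^2}\log\frac{(a+1)^2}{4a}.$$ Equivalently, as $\theta\to0$ in every strip $\{\theta\in\mathbb C:|\operatorname{Im}\theta|<\theta_*\}$, $0<\theta_*<\pi$, $$\mathcal C_a(\theta)=\frac1{2\pi^2}\log\frac{(a+1)^2}{4a}\,\theta^2+O(|\theta|^3).$$
   Context: Let $\mathbb H=\{z\in\mathbb C:\operatorname{Im}z>0\}$ with planar Lebesgue measure $\mathrm dA$, and let $\mathcal Z$ be the determinantal point process on $(\mathbb H,\mathrm dA)$ with Hermitian correlation kernel $K_{\mathbb H}(z,w)=-\frac{1}{\pi(z-\overline w)^2}$. For $a>1$, $L>0$ set $N_a(L):=\#\{z\in\mathcal Z:0\le\operatorname{Re}z\le L,\ 1\le\operatorname{Im}z\le a\}$. Let $S_\pi:=\{\theta\in\mathbb C:|\operatorname{Im}\theta|<\pi\}$ and $\Lambda_a(\theta)=\frac1{2\pi}\int_0^\infty\log(1+(e^\theta-1)(e^{-2\xi}-e^{-2a\xi}))\,\mathrm d\xi$ on $S_\pi$ (logarithm continued analytically from $\theta=0$). The strong Szegő correction $\mathcal C_a:S_\pi\to\mathbb C$ is the holomorphic function $$\mathcal C_a(\theta)=\lim_{L\to\infty}\left[\log\mathbb E\exp(\theta N_a(L))-L\Lambda_a(\theta)\right],$$ the limit being known to exist locally uniformly on $S_\pi$, where $\log\mathbb E\exp(\theta N_a(L))$ is the holomorphic branch on $S_\pi$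 vanishing at $\theta=0$. *)

theory Defs
  imports
    "HOL-Probability.Probability"
    "HOL-Complex_Analysis.Complex_Analysis"
    "Jordan_Normal_Form.Determinant"
begin

locale simple_point_process = prob_space M
  for M :: "'w measure" and Z :: "'w \<Rightarrow> complex set" and S :: "complex set" +
  assumes points_in: "\<omega> \<in> space M \<Longrightarrow> Z \<omega> \<subseteq> S"
    and locally_finite: "\<omega> \<in> space M \<Longrightarrow> compact C \<Longrightarrow> C \<subseteq> S \<Longrightarrow> finite (Z \<omega> \<inter> C)"
    and count_measurable: "compact C \<Longrightarrow> C \<subseteq> S \<Longrightarrow> B \<in> sets borel \<Longrightarrow> B \<subseteq> C \<Longrightarrow>
      (\<lambda>\<omega>. card (Z \<omega> \<inter> B)) \<in> measurable M (count_space UNIV)"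

text \<open>
  The determinants are the correlation functions with respect to planar Lebesgue measure on
  \<open>S\<close>: the expected sum of \<open>f\<close> over ordered \<open>n\<close>-tuples of pairwise distinct points equals the
  integral of \<open>f\<close> against the determinant.  For a Hermitian, positive semidefinite kernel the
  determinants are nonnegative reals, so \<open>ennreal (Re _)\<close> loses nothing.
\<close>

locale determinantal_point_process = simple_point_process M Z S
  for M :: "'w measure" and Z :: "'w \<Rightarrow> complex set" and S :: "complex set" +
  fixes K :: "complex \<Rightarrow> complex \<Rightarrow> complex"
  assumes correlation:
    "f \<in> borel_measurable (Pi\<^sub>M {..<n} (\<lambda>_. restrict_space lborel S)) \<Longrightarrow>
      (\<integral>\<^sup>+ \<omega>. (\<integral>\<^sup>+ x. f x \<partial>count_space {x \<in> {..<n} \<rightarrow>\<^sub>E Z \<omega>. inj_on x {..<n}}) \<partial>M) =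
      (\<integral>\<^sup>+ x. f x * ennreal (Re (Determinant.det (mat n n (\<lambda>(i, j). K (x i) (x j)))))
        \<partial>Pi\<^sub>M {..<n} (\<lambda>_. restrict_space lborel S))"

definition upper_half_plane :: "complex set" where
  "upper_half_plane = {z. Im z > 0}"

definition K_H :: "complex \<Rightarrow> complex \<Rightarrow> complex" where
  "K_H z w = - 1 / (of_real pi * (z - cnj w)\<^sup>2)"

definition count_N :: "('w \<Rightarrow> complex set) \<Rightarrow> real \<Rightarrow> real \<Rightarrow> 'w \<Rightarrow> nat" where
  "count_N Z a L \<omega> = card {z \<in> Z \<omega>. 0 \<le> Re z \<and> Re z \<le> L \<and> 1 \<le> Im z \<and> Im z \<le> a}"

definition strip :: "real \<Rightarrow> complex set" where
  "strip r = {\<theta>. \<bar>Im \<theta>\<bar> < r}"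

definition is_log_branch :: "(complex \<Rightarrow> complex) \<Rightarrow> (complex \<Rightarrow> complex) \<Rightarrow> bool" where
  "is_log_branch f g \<longleftrightarrow>
    g holomorphic_on strip pi \<and> g 0 = 0 \<and> (\<forall>\<theta> \<in> strip pi. exp (g \<theta>) = f \<theta>)"

lemma is_log_branch_unique:
  assumes "is_log_branch f g" "is_log_branch f h" "\<theta> \<in> strip pi"
  shows "g \<theta> = h \<theta>"
proof -
  have strip: "connected (strip pi)" "open (strip pi)" "0 \<in> strip pi"
  proof -
    have eq: "strip pi = {z. Im z < pi} \<inter> {z. Im z > - pi}"
      by (auto simp: strip_def abs_less_iff)
    show "open (strip pi)"
      unfolding eq by (intro open_Int open_halfspace_Im_lt open_halfspace_Im_gt)
    show "connected (strip pi)"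
      unfolding eq
      by (intro convex_connected convex_Int convex_halfspace_Im_lt convex_halfspace_Im_gt)
  qed (auto simp: strip_def)
  define d where "d = (\<lambda>z. g z - h z)"
  have e1: "exp (d z) = 1" if "z \<in> strip pi" for z
    using assms that by (auto simp: is_log_branch_def d_def exp_diff)
  have hol: "d holomorphic_on strip pi"
    using assms unfolding d_def is_log_branch_def by (auto intro: holomorphic_intros)
  have "d constant_on strip pi"
  proof (rule continuous_discrete_range_constant[OF strip(1)])
    show "continuous_on (strip pi) d" using hol holomorphic_on_imp_continuous_on by blast
    fix x assume x: "x \<in> strip pi"
    show "\<exists>e>0. \<forall>y. y \<in> strip pi \<and> d y \<noteq> d x \<longrightarrow> e \<le> cmod (d y - d x)"
    proof (intro exI[of _ "2 * pi"] conjI allI impI)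
      fix y assume y: "y \<in> strip pi \<and> d y \<noteq> d x"
      have "exp (d y - d x) = 1" using e1 x y by (simp add: exp_diff)
      then obtain n :: int where n: "Re (d y - d x) = 0" "Im (d y - d x) = of_int (2 * n) * pi"
        by (auto simp: exp_eq_1)
      have "n \<noteq> 0" using n y by (auto simp: complex_eq_iff)
      then have "1 \<le> \<bar>real_of_int n\<bar>" by linarith
      then have "2 * pi \<le> \<bar>Im (d y - d x)\<bar>" unfolding n by (simp add: abs_mult)
      also have "\<dots> \<le> cmod (d y - d x)" by (rule abs_Im_le_cmod)
      finally show "2 * pi \<le> cmod (d y - d x)" .
    qed simp
  qed
  moreover have "d 0 = 0" using assms by (auto simp: d_def is_log_branch_def)
  ultimately have "d \<theta> = 0" using strip(3) assms(3) unfolding constant_on_def by metis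
  then show ?thesis by (simp add: d_def)
qed

definition Lambda :: "real \<Rightarrow> complex \<Rightarrow> complex" where
  "Lambda a \<theta> = 1 / (2 * of_real pi) *
    (LINT \<xi>:{0..}|lborel.
      Ln (1 + (exp \<theta> - 1) * of_real (exp (- 2 * \<xi>) - exp (- 2 * a * \<xi>))))"

text \<open>
  The principal logarithm in \<open>Lambda\<close> is the analytic continuation from \<open>\<theta> = 0\<close>: on the strip its
  argument never meets the branch cut.
\<close>

lemma is_log_branch_Ln:
  assumes "a > 1" "\<xi> \<ge> 0"
  defines "f \<equiv> \<lambda>\<theta>. 1 + (exp \<theta> - 1) * complex_of_real (exp (- 2 * \<xi>) - exp (- 2 * a * \<xi>))"
  shows "is_log_branch f (\<lambda>\<theta>. Ln (f \<theta>))"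
proof -
  define p where "p = exp (- 2 * \<xi>) - exp (- 2 * a * \<xi>)"
  have "\<xi> \<le> a * \<xi>" using assms by (simp add: mult_le_cancel_right1)
  then have "0 \<le> p" unfolding p_def by simp
  moreover have "p < 1" using assms(2) unfolding p_def
    by (smt (verit) exp_gt_zero exp_le_one_iff)
  ultimately have p: "0 \<le> p" "p < 1" by auto
  have f: "f \<theta> = 1 + (exp \<theta> - 1) * of_real p" for \<theta> by (simp add: f_def p_def)
  have nonpos: "f \<theta> \<notin> \<real>\<^sub>\<le>\<^sub>0" if "\<theta> \<in> strip pi" for \<theta>
  proof
    assume "f \<theta> \<in> \<real>\<^sub>\<le>\<^sub>0"
    then have re: "1 + (exp (Re \<theta>) * cos (Im \<theta>) - 1) * p \<le> 0" and "sin (Im \<theta>) * p = 0"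
      by (auto simp: f complex_nonpos_Reals_iff Re_exp Im_exp)
    have "p \<noteq> 0" using re by auto
    then have "sin (Im \<theta>) = 0" using \<open>sin (Im \<theta>) * p = 0\<close> by simp
    then have "Im \<theta> = 0"
      using that sin_eq_0_pi[of "Im \<theta>"] by (auto simp: strip_def)
    then have "1 - p + exp (Re \<theta>) * p \<le> 0" using re by (simp add: algebra_simps)
    then show False using p by (smt (verit) mult_nonneg_nonneg exp_gt_zero)
  qed
  have "f holomorphic_on strip pi" unfolding f by (intro holomorphic_intros)
  then have "(\<lambda>\<theta>. Ln (f \<theta>)) holomorphic_on strip pi"
    using nonpos by (intro holomorphic_on_Ln') auto
  moreover have "exp (Ln (f \<theta>)) = f \<theta>" if "\<theta> \<in> strip pi" for \<theta>
    using nonpos[OF that] by (intro exp_Ln) auto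
  ultimately show ?thesis by (simp add: is_log_branch_def f_def)
qed

text \<open>
  \<open>log_mgf L\<close> is the holomorphic branch of the logarithm of \<open>\<theta> \<mapsto> E exp (\<theta> N\<^sub>a(L))\<close>, and \<open>C\<close> its
  renormalised limit; both are determined on the strip by the conditions below.
\<close>

definition is_szego_correction ::
  "'w measure \<Rightarrow> ('w \<Rightarrow> complex set) \<Rightarrow> real \<Rightarrow> (complex \<Rightarrow> complex) \<Rightarrow> bool" where
  "is_szego_correction M Z a C \<longleftrightarrow> C holomorphic_on strip pi \<and>
    (\<exists>log_mgf :: real \<Rightarrow> complex \<Rightarrow> complex.
      (\<forall>L>0. is_log_branch
        (\<lambda>\<theta>. prob_space.expectation M (\<lambda>\<omega>. exp (\<theta> * of_nat (count_N Z a L \<omega>)))) (log_mgf L)) \<and>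
      (\<forall>D. compact D \<longrightarrow> D \<subseteq> strip pi \<longrightarrow>
        uniform_limit D (\<lambda>L \<theta>. log_mgf L \<theta> - of_real L * Lambda a \<theta>) C at_top))"

end

theory Submission
  imports Defs "HOL-Real_Asymp.Real_Asymp"
begin

text \<open>
  Write \<open>g L \<theta>\<close> for \<open>log E exp (\<theta> N(L))\<close>.  Since \<open>g L - L \<Lambda>\<close> converges to \<open>C\<close> uniformly near \<open>0\<close>, the
  combination \<open>2 g L - g (2 L)\<close> converges to \<open>2 C - C = C\<close> as well, because the
  term linear in \<open>L\<close> cancels.  A uniform limit of holomorphic functions can be differentiated term by term
  (\<open>szego_correction_eq_limit\<close> and \<open>higher_deriv_complex_uniform_limit\<close>), so the Taylor coefficients
  of \<open>C\<close> at \<open>0\<close> are the limits of the corresponding combinations of cumulants of \<open>N(L)\<close>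
  (\<open>cumulants_of_log_mgf\<close>).  The mean is exactly linear in \<open>L\<close>, whence \<open>C'(0) = 0\<close>, and \<open>C''(0)\<close> is the
  limit of \<open>2 Var N(L) - Var N(2 L)\<close>.

  For a determinantal process with Hermitian kernel, the one- and two-point correlation functions
  give \<open>Var N(L) = E N(L) - J(L)\<close>, where \<open>J(L)\<close> is the integral of \<open>\<bar>K(z,w)\<bar>\<^sup>2\<close> over pairs of points
  in the window (\<open>mean_variance_count_N\<close>).  Here \<open>\<bar>K(z,w)\<bar>\<^sup>2 = 1 / (\<pi>\<^sup>2 ((x - x')\<^sup>2 + (y + y')\<^sup>2)\<^sup>2)\<close> depends only
  on the difference of the real parts and on the sum of the imaginary parts.  An integral over a
  square of a function of \<open>x - x'\<close> or of \<open>y + y'\<close> is a second difference of a second primitive, and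
  both second primitives are elementary: integrating over \<open>x, x'\<close> gives \<open>L arctan (L / s) / s\<^sup>3\<close> with
  \<open>s = y + y'\<close>, and a second primitive of this in \<open>s\<close> is \<open>int_K_sq_primitive L\<close>.  Thus \<open>J(L)\<close> is
  explicit, and it expands as a multiple of \<open>L\<close> minus \<open>\<pi>\<^sup>-\<^sup>2 ln ((a + 1)\<^sup>2 / (4 a))\<close> plus \<open>o(1)\<close>.  The limit
  of \<open>J(2 L) - 2 J(L)\<close> is therefore the asserted value of \<open>C''(0)\<close>.  The cubic error bound is Taylor's
  theorem for the holomorphic function \<open>C\<close>.
\<close>

section \<open>Cumulants from the logarithmic moment generating function\<close>

text \<open>
  One exponential moment controls all power moments, because \<open>x ^ k / k!\<close> is a single term of the
  series of \<open>exp x\<close>.  The factorial in the bound makes the series of the next lemma geometric.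
\<close>

lemma (in prob_space) integrable_power_of_integrable_exp:
  fixes X :: "'a \<Rightarrow> real"
  assumes [measurable]: "X \<in> borel_measurable M" and nonneg: "\<And>\<omega>. X \<omega> \<ge> 0"
    and exp: "integrable M (\<lambda>\<omega>. exp (X \<omega>))"
  shows "integrable M (\<lambda>\<omega>. X \<omega> ^ k)"
    and "expectation (\<lambda>\<omega>. X \<omega> ^ k) \<le> fact k * expectation (\<lambda>\<omega>. exp (X \<omega>))"
proof -
  have le: "X \<omega> ^ k \<le> fact k * exp (X \<omega>)" for \<omega>
  proof -
    have "(\<Sum>i\<in>{k}. X \<omega> ^ i /\<^sub>R fact i) \<le> (\<Sum>i. X \<omega> ^ i /\<^sub>R fact i)"
      by (rule sum_le_suminf) (use nonneg summable_exp_generic[of "X \<omega>"] in \<open>auto simp: scaleR_conv_of_real\<close>)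
    then show ?thesis
      by (simp add: exp_def field_simps)
  qed
  show int: "integrable M (\<lambda>\<omega>. X \<omega> ^ k)"
    by (rule Bochner_Integration.integrable_bound[where f = "\<lambda>\<omega>. fact k * exp (X \<omega>)"])
      (use exp le nonneg in auto)
  have "expectation (\<lambda>\<omega>. X \<omega> ^ k) \<le> expectation (\<lambda>\<omega>. fact k * exp (X \<omega>))"
    using int exp le by (intro integral_mono) auto
  then show "expectation (\<lambda>\<omega>. X \<omega> ^ k) \<le> fact k * expectation (\<lambda>\<omega>. exp (X \<omega>))"
    by simp
qed

text \<open>
  Expand the exponential and integrate term by term: by the previous bound the \<open>k\<close>-th term has
  integral at most \<open>B \<bar>\<theta>\<bar> ^ k\<close>, so this is legitimate on the unit disc.
\<close>

lemma (in prob_space) mgf_has_fps_expansion: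
  fixes X :: "'a \<Rightarrow> real"
  assumes X [measurable]: "X \<in> borel_measurable M" and nonneg: "\<And>\<omega>. X \<omega> \<ge> 0"
    and exp: "integrable M (\<lambda>\<omega>. exp (X \<omega>))"
  shows "(\<lambda>\<theta>. expectation (\<lambda>\<omega>. exp (\<theta> * complex_of_real (X \<omega>)))) has_fps_expansion
    Abs_fps (\<lambda>k. of_real (expectation (\<lambda>\<omega>. X \<omega> ^ k) / fact k))"
    (is "?\<phi> has_fps_expansion ?F")
proof -
  note moment = integrable_power_of_integrable_exp[OF X nonneg exp]
  define B where "B = expectation (\<lambda>\<omega>. exp (X \<omega>))"
  have sums: "(\<lambda>k. fps_nth ?F k * \<theta> ^ k) sums ?\<phi> \<theta>" if \<theta>: "norm \<theta> < 1" for \<theta>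
  proof -
    define f where "f = (\<lambda>k \<omega>. (\<theta> * complex_of_real (X \<omega>)) ^ k /\<^sub>R fact k)"
    have f_eq: "f k \<omega> = \<theta> ^ k / fact k * of_real (X \<omega> ^ k)" for k \<omega>
      by (simp add: f_def power_mult_distrib scaleR_conv_of_real field_simps)
    have norm_f: "norm (f k \<omega>) = norm \<theta> ^ k / fact k * X \<omega> ^ k" for k \<omega>
      using nonneg[of \<omega>] by (simp add: f_eq norm_mult norm_power norm_divide)
    have int_f: "integrable M (f k)" for k
      unfolding f_eq by (intro integrable_mult_right integrable_of_real moment(1))
    have "(\<lambda>k. integral\<^sup>L M (f k)) sums (\<integral>\<omega>. (\<Sum>k. f k \<omega>) \<partial>M)"
    proof (rule sums_integral[OF int_f])
      show "AE \<omega> in M. summable (\<lambda>k. norm (f k \<omega>))"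
        unfolding f_def using summable_norm_exp by blast
      show "summable (\<lambda>k. \<integral>\<omega>. norm (f k \<omega>) \<partial>M)"
      proof (rule summable_comparison_test')
        show "summable (\<lambda>k. B * norm \<theta> ^ k)"
          using \<theta> by (intro summable_mult summable_geometric) simp
        show "norm (\<integral>\<omega>. norm (f k \<omega>) \<partial>M) \<le> B * norm \<theta> ^ k" for k
        proof -
          have "norm (\<integral>\<omega>. norm (f k \<omega>) \<partial>M) = (\<integral>\<omega>. norm (f k \<omega>) \<partial>M)"
            by (simp add: integral_nonneg_AE)
          also have "\<dots> = norm \<theta> ^ k / fact k * expectation (\<lambda>\<omega>. X \<omega> ^ k)"
            unfolding norm_f by simp
          also have "\<dots> \<le> norm \<theta> ^ k / fact k * (fact k * B)"
            using moment(2)[of k] unfolding B_def by (intro mult_left_mono) auto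
          finally show ?thesis by (simp add: field_simps)
        qed
      qed
    qed
    moreover have "integral\<^sup>L M (f k) = fps_nth ?F k * \<theta> ^ k" for k
    proof -
      have "integral\<^sup>L M (f k) = \<theta> ^ k / fact k * (\<integral>\<omega>. complex_of_real (X \<omega> ^ k) \<partial>M)"
        unfolding f_eq by (rule integral_mult_right_zero)
      also have "(\<integral>\<omega>. complex_of_real (X \<omega> ^ k) \<partial>M) = of_real (expectation (\<lambda>\<omega>. X \<omega> ^ k))"
        by (rule integral_of_real[OF moment(1)])
      finally show ?thesis by simp
    qed
    moreover have "(\<Sum>k. f k \<omega>) = exp (\<theta> * complex_of_real (X \<omega>))" for \<omega>
      by (simp add: f_def exp_def)
    ultimately show ?thesis by simp
  qed
  have "fps_conv_radius ?F \<ge> norm (1 / 2 :: complex)"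
    unfolding fps_conv_radius_def
    by (rule conv_radius_geI) (use sums[of "1/2"] in \<open>auto dest: sums_summable\<close>)
  then have "fps_conv_radius ?F > 0"
    by (rule less_le_trans[rotated]) simp
  moreover have "eventually (\<lambda>\<theta>. \<theta> \<in> ball 0 1) (nhds (0 :: complex))"
    by (intro eventually_nhds_in_open) auto
  then have "eventually (\<lambda>\<theta>. eval_fps ?F \<theta> = ?\<phi> \<theta>) (nhds 0)"
    by eventually_elim (use sums in \<open>auto simp: eval_fps_def sums_iff\<close>)
  ultimately show ?thesis unfolding has_fps_expansion_def by blast
qed

text \<open>
  Differentiating \<open>\<phi> = exp \<circ> g\<close> twice gives \<open>\<phi>' = \<phi> g'\<close> and \<open>\<phi>'' = \<phi> (g'' + g'\<^sup>2)\<close>, and \<open>\<phi> z = 1\<close>.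
\<close>

lemma derivs_of_holomorphic_log:
  assumes S: "open S" "z \<in> S" and g: "g holomorphic_on S"
    and eq: "\<And>w. w \<in> S \<Longrightarrow> exp (g w) = \<phi> w" and z: "g z = 0"
  shows "deriv g z = deriv \<phi> z"
    and "(deriv ^^ 2) g z = (deriv ^^ 2) \<phi> z - (deriv \<phi> z)\<^sup>2"
proof -
  have dg: "(g has_field_derivative deriv g w) (at w)" if "w \<in> S" for w
    using that g S holomorphic_derivI by blast
  have ddg: "(deriv g has_field_derivative deriv (deriv g) w) (at w)" if "w \<in> S" for w
    using that g S holomorphic_derivI[OF holomorphic_deriv] by blast
  have ev: "eventually (\<lambda>w. w \<in> S) (nhds w)" if "w \<in> S" for w
    using S that eventually_nhds_in_open by blast
  have d\<phi>: "deriv \<phi> w = exp (g w) * deriv g w" if w: "w \<in> S" for w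
  proof -
    have "deriv \<phi> w = deriv (\<lambda>w. exp (g w)) w"
      by (rule deriv_cong_ev) (use ev[OF w] in \<open>auto elim!: eventually_mono simp: eq\<close>)
    also have "\<dots> = exp (g w) * deriv g w"
      by (rule DERIV_imp_deriv) (auto intro!: derivative_eq_intros dg w)
    finally show ?thesis .
  qed
  show 1: "deriv g z = deriv \<phi> z" using d\<phi>[OF S(2)] z by simp
  have "deriv (deriv \<phi>) z = deriv (\<lambda>w. exp (g w) * deriv g w) z"
    by (rule deriv_cong_ev) (use ev[OF S(2)] in \<open>auto elim!: eventually_mono simp: d\<phi>\<close>)
  also have "\<dots> = exp (g z) * deriv (deriv g) z + exp (g z) * deriv g z * deriv g z"
    by (rule DERIV_imp_deriv)
      (auto intro!: derivative_eq_intros dg ddg S simp: algebra_simps)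
  finally show "(deriv ^^ 2) g z = (deriv ^^ 2) \<phi> z - (deriv \<phi> z)\<^sup>2"
    using z 1 by (simp add: numeral_2_eq_2 power2_eq_square)
qed

lemma open_strip: "open (strip r)"
proof -
  have "strip r = {z. Im z < r} \<inter> {z. Im z > - r}" by (auto simp: strip_def abs_less_iff)
  then show ?thesis by (simp add: open_Int open_halfspace_Im_lt open_halfspace_Im_gt)
qed

lemma cball_subset_strip: "r < R \<Longrightarrow> cball 0 r \<subseteq> strip R"
  using abs_Im_le_cmod by (force simp: strip_def intro: order.strict_trans1)

text \<open>
  The existence of a logarithm on the strip already forces \<open>X\<close> to have exponential moments: the
  Bochner integral of a non-integrable function is \<open>0\<close>, which is not a value of \<open>exp\<close>.
\<close>

lemma (in prob_space) cumulants_of_log_mgf: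
  fixes X :: "'a \<Rightarrow> nat"
  assumes X [measurable]: "X \<in> measurable M (count_space UNIV)"
    and branch: "is_log_branch (\<lambda>\<theta>. expectation (\<lambda>\<omega>. exp (\<theta> * of_nat (X \<omega>)))) g"
  shows "integrable M (\<lambda>\<omega>. real (X \<omega>))" "integrable M (\<lambda>\<omega>. (real (X \<omega>))\<^sup>2)"
    and "deriv g 0 = of_real (expectation (\<lambda>\<omega>. real (X \<omega>)))"
    and "(deriv ^^ 2) g 0 = of_real (variance (\<lambda>\<omega>. real (X \<omega>)))"
proof -
  define \<phi> where "\<phi> = (\<lambda>\<theta>. expectation (\<lambda>\<omega>. exp (\<theta> * complex_of_real (real (X \<omega>)))))"
  have \<phi>: "exp (g \<theta>) = \<phi> \<theta>" if "\<theta> \<in> strip pi" for \<theta>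
    using branch that by (simp add: is_log_branch_def \<phi>_def)
  have [measurable]: "(\<lambda>\<omega>. real (X \<omega>)) \<in> borel_measurable M" by measurable
  have exp_int: "integrable M (\<lambda>\<omega>. exp (real (X \<omega>)))"
  proof -
    have "\<phi> 1 \<noteq> 0" using \<phi>[of 1] exp_not_eq_zero[of "g 1"] by (simp add: strip_def)
    then have "integrable M (\<lambda>\<omega>. exp (1 * complex_of_real (real (X \<omega>))))"
      unfolding \<phi>_def using not_integrable_integral_eq by blast
    then have "integrable M (\<lambda>\<omega>. norm (exp (1 * complex_of_real (real (X \<omega>)))))"
      by (rule integrable_norm)
    then show ?thesis by simp
  qed
  note fps = mgf_has_fps_expansion[OF \<open>(\<lambda>\<omega>. real (X \<omega>)) \<in> borel_measurable M\<close> _ exp_int,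
      folded \<phi>_def]
  note moment = integrable_power_of_integrable_exp(1)
    [OF \<open>(\<lambda>\<omega>. real (X \<omega>)) \<in> borel_measurable M\<close> _ exp_int]
  show int1: "integrable M (\<lambda>\<omega>. real (X \<omega>))" using moment[of 1] by simp
  show int2: "integrable M (\<lambda>\<omega>. (real (X \<omega>))\<^sup>2)" using moment[of 2] by simp
  have D: "(deriv ^^ k) \<phi> 0 = of_real (expectation (\<lambda>\<omega>. real (X \<omega>) ^ k))" for k
    using fps_nth_fps_expansion[OF fps, of k] by (simp add: field_simps)
  have D1: "deriv \<phi> 0 = of_real (expectation (\<lambda>\<omega>. real (X \<omega>)))" using D[of 1] by simp
  have g: "g holomorphic_on strip pi" "g 0 = 0" using branch by (auto simp: is_log_branch_def)
  note log = derivs_of_holomorphic_log[OF open_strip _ g(1) \<phi> g(2)]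
  have 0: "0 \<in> strip pi" by (simp add: strip_def)
  show "deriv g 0 = of_real (expectation (\<lambda>\<omega>. real (X \<omega>)))" using log(1)[OF 0] D1 by simp
  show "(deriv ^^ 2) g 0 = of_real (variance (\<lambda>\<omega>. real (X \<omega>)))"
    using log(2)[OF 0] D1 D[of 2] variance_eq[OF int1 int2] by simp
qed

section \<open>Integration over a window in the half-plane\<close>

text \<open>
  The imaginary part is put outermost because the kernel integral below is first evaluated in the
  real parts.
\<close>

lemma lborel_complex_eq_distr: "(lborel :: complex measure) =
    distr (lborel \<Otimes>\<^sub>M lborel) borel (\<lambda>(y, x). Complex x y)"
proof (rule lborel_eqI)
  fix l u :: complex
  assume le: "\<And>b. b \<in> Basis \<Longrightarrow> l \<bullet> b \<le> u \<bullet> b"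
  have [measurable]: "(\<lambda>(y, x). Complex x y) \<in> borel_measurable (lborel \<Otimes>\<^sub>M lborel)"
    unfolding Complex_eq by measurable
  have "(\<lambda>(y, x). Complex x y) -` box l u \<inter> space (lborel \<Otimes>\<^sub>M lborel)
      = box (Im l) (Im u) \<times> box (Re l) (Re u)"
    by (auto simp: in_box_complex_iff space_pair_measure)
  then have "emeasure (distr (lborel \<Otimes>\<^sub>M lborel) borel (\<lambda>(y, x). Complex x y)) (box l u) =
      emeasure (lborel \<Otimes>\<^sub>M lborel) (box (Im l) (Im u) \<times> box (Re l) (Re u))"
    by (subst emeasure_distr) auto
  also have "\<dots> = emeasure lborel (box (Im l) (Im u)) * emeasure lborel (box (Re l) (Re u))"
    by (intro lborel.emeasure_pair_measure_Times) auto
  also have "\<dots> = (\<Prod>b\<in>Basis. (u - l) \<bullet> b)"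
    using le[of 1] le[of \<i>]
    by (simp add: Basis_complex_def ennreal_mult[symmetric] mult.commute)
  finally show "emeasure (distr (lborel \<Otimes>\<^sub>M lborel) borel (\<lambda>(y, x). Complex x y)) (box l u)
      = (\<Prod>b\<in>Basis. (u - l) \<bullet> b)" .
qed simp

lemma nn_integral_lborel_complex:
  assumes [measurable]: "f \<in> borel_measurable (borel :: complex measure)"
  shows "(\<integral>\<^sup>+z. f z \<partial>lborel) = (\<integral>\<^sup>+y. (\<integral>\<^sup>+x. f (Complex x y) \<partial>lborel) \<partial>lborel)"
proof -
  have [measurable]: "(\<lambda>(y, x). Complex x y) \<in> borel_measurable (lborel \<Otimes>\<^sub>M lborel)"
    unfolding Complex_eq by measurable
  show ?thesis
    using lborel.nn_integral_fst[of "\<lambda>p. f (case p of (y, x) \<Rightarrow> Complex x y)" lborel]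
    by (subst lborel_complex_eq_distr) (simp add: nn_integral_distr)
qed

definition box_in_H :: "real \<Rightarrow> real \<Rightarrow> complex set" where
  "box_in_H a L = {z. 0 \<le> Re z \<and> Re z \<le> L \<and> 1 \<le> Im z \<and> Im z \<le> a}"

lemma box_in_H_eq_cbox: "box_in_H a L = cbox (Complex 0 1) (Complex L a)"
  by (auto simp: box_in_H_def in_cbox_complex_iff)

lemma compact_box_in_H: "compact (box_in_H a L)"
  by (simp add: box_in_H_eq_cbox)

lemma box_in_H_subset: "box_in_H a L \<subseteq> upper_half_plane"
  by (auto simp: box_in_H_def upper_half_plane_def)

lemma borel_box_in_H [measurable]: "box_in_H a L \<in> sets borel"
  using compact_box_in_H by (simp add: borel_compact)

lemma nn_integral_box_in_H:
  assumes [measurable]: "f \<in> borel_measurable (borel :: complex measure)"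
  shows "(\<integral>\<^sup>+z. f z * indicator (box_in_H a L) z \<partial>lborel) =
    (\<integral>\<^sup>+y. (\<integral>\<^sup>+x. f (Complex x y) * indicator {0..L} x \<partial>lborel) * indicator {1..a} y \<partial>lborel)"
proof -
  have [measurable]: "(\<lambda>x. Complex x y) \<in> borel_measurable borel" for y
    unfolding Complex_eq by measurable
  have "(\<integral>\<^sup>+z. f z * indicator (box_in_H a L) z \<partial>lborel) =
      (\<integral>\<^sup>+y. (\<integral>\<^sup>+x. f (Complex x y) * indicator (box_in_H a L) (Complex x y) \<partial>lborel) \<partial>lborel)"
    by (rule nn_integral_lborel_complex) measurable
  also have "\<dots> = (\<integral>\<^sup>+y. (\<integral>\<^sup>+x. (f (Complex x y) * indicator {0..L} x) * indicator {1..a} y \<partial>lborel) \<partial>lborel)"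
    by (intro nn_integral_cong) (auto simp: box_in_H_def indicator_def)
  also have "\<dots> = (\<integral>\<^sup>+y. (\<integral>\<^sup>+x. f (Complex x y) * indicator {0..L} x \<partial>lborel) * indicator {1..a} y \<partial>lborel)"
    by (intro nn_integral_cong nn_integral_multc) measurable
  finally show ?thesis .
qed

text \<open>
  For two points in the window, Tonelli's theorem lets both real parts be integrated before both
  imaginary parts.
\<close>

lemma nn_integral_box_in_H_pair:
  fixes f :: "complex \<Rightarrow> complex \<Rightarrow> ennreal"
  assumes f: "case_prod f \<in> borel_measurable (borel \<Otimes>\<^sub>M borel)"
  shows "(\<integral>\<^sup>+z. (\<integral>\<^sup>+w. f z w * indicator (box_in_H a L) w \<partial>lborel) * indicator (box_in_H a L) z \<partial>lborel) =
    (\<integral>\<^sup>+y. (\<integral>\<^sup>+y'. (\<integral>\<^sup>+x. (\<integral>\<^sup>+x'. f (Complex x y) (Complex x' y') * indicator {0..L} x' \<partial>lborel)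
      * indicator {0..L} x \<partial>lborel) * indicator {1..a} y' \<partial>lborel) * indicator {1..a} y \<partial>lborel)"
proof -
  have f' [measurable]: "(\<lambda>x. f (g x) (h x)) \<in> borel_measurable N"
    if "g \<in> borel_measurable N" "h \<in> borel_measurable N" for g h and N :: "'n measure"
    using measurable_compose[OF measurable_Pair[OF that] f] by simp
  have Complex [measurable]: "(\<lambda>x. Complex (g x) (h x)) \<in> borel_measurable N"
    if [measurable]: "g \<in> borel_measurable N" "h \<in> borel_measurable N" for g h and N :: "'n measure"
    unfolding Complex_eq by measurable
  define I where "I = (\<lambda>z y'. \<integral>\<^sup>+x'. f z (Complex x' y') * indicator {0..L} x' \<partial>lborel)"
  have I [measurable]: "(\<lambda>x. I (g x) (h x)) \<in> borel_measurable N"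
    if [measurable]: "g \<in> borel_measurable N" "h \<in> borel_measurable N" for g h and N :: "'n measure"
    unfolding I_def by measurable
  have "(\<integral>\<^sup>+z. (\<integral>\<^sup>+w. f z w * indicator (box_in_H a L) w \<partial>lborel) * indicator (box_in_H a L) z \<partial>lborel)
      = (\<integral>\<^sup>+z. (\<integral>\<^sup>+y'. I z y' * indicator {1..a} y' \<partial>lborel) * indicator (box_in_H a L) z \<partial>lborel)"
    unfolding I_def by (subst nn_integral_box_in_H) auto
  also have "\<dots> = (\<integral>\<^sup>+y. (\<integral>\<^sup>+x. (\<integral>\<^sup>+y'. I (Complex x y) y' * indicator {1..a} y' \<partial>lborel)
      * indicator {0..L} x \<partial>lborel) * indicator {1..a} y \<partial>lborel)"
    by (rule nn_integral_box_in_H) measurable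
  also have "\<dots> = (\<integral>\<^sup>+y. (\<integral>\<^sup>+y'. (\<integral>\<^sup>+x. I (Complex x y) y' * indicator {0..L} x \<partial>lborel)
      * indicator {1..a} y' \<partial>lborel) * indicator {1..a} y \<partial>lborel)"
  proof (rule nn_integral_cong)
    fix y :: real
    have "(\<integral>\<^sup>+x. (\<integral>\<^sup>+y'. I (Complex x y) y' * indicator {1..a} y' \<partial>lborel) * indicator {0..L} x \<partial>lborel)
        = (\<integral>\<^sup>+x. (\<integral>\<^sup>+y'. I (Complex x y) y' * indicator {1..a} y' * indicator {0..L} x \<partial>lborel) \<partial>lborel)"
      by (intro nn_integral_cong nn_integral_multc[symmetric]) measurable
    also have "\<dots> = (\<integral>\<^sup>+y'. (\<integral>\<^sup>+x. I (Complex x y) y' * indicator {1..a} y' * indicator {0..L} x \<partial>lborel) \<partial>lborel)"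
      by (rule lborel_pair.Fubini') measurable
    also have "\<dots> = (\<integral>\<^sup>+y'. (\<integral>\<^sup>+x. I (Complex x y) y' * indicator {0..L} x * indicator {1..a} y' \<partial>lborel) \<partial>lborel)"
      by (simp add: mult_ac)
    also have "\<dots> = (\<integral>\<^sup>+y'. (\<integral>\<^sup>+x. I (Complex x y) y' * indicator {0..L} x \<partial>lborel) * indicator {1..a} y' \<partial>lborel)"
      by (intro nn_integral_cong nn_integral_multc) measurable
    finally show "(\<integral>\<^sup>+x. (\<integral>\<^sup>+y'. I (Complex x y) y' * indicator {1..a} y' \<partial>lborel) * indicator {0..L} x \<partial>lborel) * indicator {1..a} y
        = (\<integral>\<^sup>+y'. (\<integral>\<^sup>+x. I (Complex x y) y' * indicator {0..L} x \<partial>lborel) * indicator {1..a} y' \<partial>lborel) * indicator {1..a} y"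
      by simp
  qed
  finally show ?thesis unfolding I_def .
qed

section \<open>The integral of the squared kernel\<close>

text \<open>
  The mixed derivative of \<open>F (y + y')\<close> is \<open>f (y + y')\<close>, so the integral over a square is the
  alternating sum of \<open>F (y + y')\<close> over its corners.  The nonnegativity is stated separately because
  \<open>ennreal\<close> truncates at \<open>0\<close>.
\<close>

lemma nn_integral_second_difference_sum:
  fixes F F' f :: "real \<Rightarrow> real"
  assumes [measurable]: "f \<in> borel_measurable borel" "F' \<in> borel_measurable borel"
    and F: "\<And>s. s \<in> {2 * p..2 * q} \<Longrightarrow> DERIV F s :> F' s"
    and F': "\<And>s. s \<in> {2 * p..2 * q} \<Longrightarrow> DERIV F' s :> f s"
    and nonneg: "\<And>s. s \<in> {2 * p..2 * q} \<Longrightarrow> f s \<ge> 0"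
    and pq: "p \<le> q"
  shows "(\<integral>\<^sup>+y. (\<integral>\<^sup>+y'. ennreal (f (y + y')) * indicator {p..q} y' \<partial>lborel) * indicator {p..q} y \<partial>lborel)
      = ennreal (F (2 * q) - 2 * F (p + q) + F (2 * p))"
    and "F (2 * q) - 2 * F (p + q) + F (2 * p) \<ge> 0"
proof -
  have inner: "(\<integral>\<^sup>+y'. ennreal (f (y + y')) * indicator {p..q} y' \<partial>lborel) = ennreal (F' (y + q) - F' (y + p))"
    and mono: "F' (y + p) \<le> F' (y + q)"
    if y: "y \<in> {p..q}" for y
  proof -
    show "(\<integral>\<^sup>+y'. ennreal (f (y + y')) * indicator {p..q} y' \<partial>lborel) = ennreal (F' (y + q) - F' (y + p))"
    proof (rule nn_integral_FTC_Icc[where F = "\<lambda>y'. F' (y + y')"])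
      show "DERIV (\<lambda>y'. F' (y + y')) y' :> f (y + y')" if "y' \<in> {p..q}" for y'
        using F'[of "y + y'"] y that by (auto simp: DERIV_shift add.commute)
      show "0 \<le> f (y + y')" if "y' \<in> {p..q}" for y'
        using y that by (intro nonneg) auto
    qed (use pq in auto)
    show "F' (y + p) \<le> F' (y + q)"
    proof (rule DERIV_nonneg_imp_nondecreasing[of "y + p" "y + q" F'])
      show "\<exists>d. DERIV F' s :> d \<and> d \<ge> 0" if "y + p \<le> s" "s \<le> y + q" for s
        using y that by (intro exI[of _ "f s"] conjI F' nonneg) auto
    qed (use pq in simp)
  qed
  have D: "DERIV (\<lambda>y. F (y + q) - F (y + p)) y :> F' (y + q) - F' (y + p)" if "y \<in> {p..q}" for y
    using F[of "y + p"] F[of "y + q"] that by (intro DERIV_diff) (auto simp: DERIV_shift)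
  have "(\<integral>\<^sup>+y. (\<integral>\<^sup>+y'. ennreal (f (y + y')) * indicator {p..q} y' \<partial>lborel) * indicator {p..q} y \<partial>lborel)
      = (\<integral>\<^sup>+y. ennreal (F' (y + q) - F' (y + p)) * indicator {p..q} y \<partial>lborel)"
  proof (rule nn_integral_cong)
    show "(\<integral>\<^sup>+y'. ennreal (f (y + y')) * indicator {p..q} y' \<partial>lborel) * indicator {p..q} y
        = ennreal (F' (y + q) - F' (y + p)) * indicator {p..q} y" for y
      using inner[of y] by (cases "y \<in> {p..q}") simp_all
  qed
  also have "\<dots> = ennreal ((F (q + q) - F (q + p)) - (F (p + q) - F (p + p)))"
    by (rule nn_integral_FTC_Icc[where F = "\<lambda>y. F (y + q) - F (y + p)"]) (use pq mono D in auto)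
  finally show "(\<integral>\<^sup>+y. (\<integral>\<^sup>+y'. ennreal (f (y + y')) * indicator {p..q} y' \<partial>lborel) * indicator {p..q} y \<partial>lborel)
      = ennreal (F (2 * q) - 2 * F (p + q) + F (2 * p))" by (simp add: algebra_simps)
  have "F (p + q) - F (p + p) \<le> F (q + q) - F (q + p)"
  proof (rule DERIV_nonneg_imp_nondecreasing[OF pq])
    show "\<exists>d. DERIV (\<lambda>y. F (y + q) - F (y + p)) y :> d \<and> 0 \<le> d" if "p \<le> y" "y \<le> q" for y
      using D[of y] mono[of y] that by (intro exI[of _ "F' (y + q) - F' (y + p)"]) auto
  qed
  then show "F (2 * q) - 2 * F (p + q) + F (2 * p) \<ge> 0" by (simp add: algebra_simps)
qed

text \<open>
  The same for a function of \<open>x - x'\<close>; the mixed derivative of \<open>F (x - x')\<close> is \<open>- f (x - x')\<close>, which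
  reverses the signs at the corners.
\<close>

lemma nn_integral_second_difference_diff:
  fixes F F' f :: "real \<Rightarrow> real"
  assumes [measurable]: "f \<in> borel_measurable borel" "F' \<in> borel_measurable borel"
    and F: "\<And>u. DERIV F u :> F' u" and F': "\<And>u. DERIV F' u :> f u"
    and nonneg: "\<And>u. f u \<ge> 0" and L: "L \<ge> 0"
  shows "(\<integral>\<^sup>+x. (\<integral>\<^sup>+x'. ennreal (f (x - x')) * indicator {0..L} x' \<partial>lborel) * indicator {0..L} x \<partial>lborel)
      = ennreal (F L - 2 * F 0 + F (- L))"
proof -
  have inner: "(\<integral>\<^sup>+x'. ennreal (f (x - x')) * indicator {0..L} x' \<partial>lborel) = ennreal (F' x - F' (x - L))"
    and mono: "F' (x - L) \<le> F' x" for x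
  proof -
    have "(\<integral>\<^sup>+x'. ennreal (f (x - x')) * indicator {0..L} x' \<partial>lborel) = ennreal (- F' (x - L) - (- F' (x - 0)))"
    proof (rule nn_integral_FTC_Icc[where F = "\<lambda>x'. - F' (x - x')"])
      show "DERIV (\<lambda>x'. - F' (x - x')) x' :> f (x - x')" for x'
        by (auto intro!: derivative_eq_intros DERIV_chain2[OF F'])
    qed (use L nonneg in auto)
    then show "(\<integral>\<^sup>+x'. ennreal (f (x - x')) * indicator {0..L} x' \<partial>lborel) = ennreal (F' x - F' (x - L))"
      by simp
    show "F' (x - L) \<le> F' x"
      using L F' nonneg by (intro DERIV_nonneg_imp_nondecreasing[of "x - L" x F']) auto
  qed
  have "(\<integral>\<^sup>+x. (\<integral>\<^sup>+x'. ennreal (f (x - x')) * indicator {0..L} x' \<partial>lborel) * indicator {0..L} x \<partial>lborel)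
      = (\<integral>\<^sup>+x. ennreal (F' x - F' (x - L)) * indicator {0..L} x \<partial>lborel)"
    by (simp add: inner)
  also have "\<dots> = ennreal ((F L - F (L - L)) - (F 0 - F (0 - L)))"
  proof (rule nn_integral_FTC_Icc[where F = "\<lambda>x. F x - F (x - L)"])
    show "DERIV (\<lambda>x. F x - F (x - L)) x :> F' x - F' (x - L)" for x
      by (auto intro!: derivative_eq_intros F DERIV_chain2[OF F])
  qed (use L mono in auto)
  finally show ?thesis by (simp add: algebra_simps)
qed

text \<open>
  The even function \<open>u arctan (u / s) / (2 s\<^sup>3)\<close> is a second primitive of \<open>1 / (u\<^sup>2 + s\<^sup>2)\<^sup>2\<close> that vanishes
  at \<open>0\<close>, so only the corners \<open>\<plusminus> L\<close> contribute.
\<close>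

lemma nn_integral_inverse_square_kernel:
  assumes s: "s > 0" and L: "L > 0"
  shows "(\<integral>\<^sup>+x. (\<integral>\<^sup>+x'. ennreal (1 / ((x - x')\<^sup>2 + s\<^sup>2)\<^sup>2) * indicator {0..L} x' \<partial>lborel) * indicator {0..L} x \<partial>lborel)
      = ennreal (L * arctan (L / s) / s ^ 3)"
proof -
  define F where "F = (\<lambda>u. u * arctan (u / s) / (2 * s ^ 3))"
  define F' where "F' = (\<lambda>u. arctan (u / s) / (2 * s ^ 3) + u / (2 * s\<^sup>2 * (u\<^sup>2 + s\<^sup>2)))"
  have pos: "u\<^sup>2 + s\<^sup>2 > 0" for u using s by (simp add: add_nonneg_pos)
  have D: "DERIV (\<lambda>u. arctan (u / s)) u :> s / (u\<^sup>2 + s\<^sup>2)" for u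
    using s pos[of u]
    by (auto intro!: derivative_eq_intros simp: field_simps power2_eq_square)
  have "(\<integral>\<^sup>+x. (\<integral>\<^sup>+x'. ennreal (1 / ((x - x')\<^sup>2 + s\<^sup>2)\<^sup>2) * indicator {0..L} x' \<partial>lborel) * indicator {0..L} x \<partial>lborel)
      = ennreal (F L - 2 * F 0 + F (- L))"
  proof (rule nn_integral_second_difference_diff[where f = "\<lambda>u. 1 / (u\<^sup>2 + s\<^sup>2)\<^sup>2"])
    show "DERIV F u :> F' u" for u
    proof -
      have "DERIV F u :> (1 * arctan (u / s) + s / (u\<^sup>2 + s\<^sup>2) * u) / (2 * s ^ 3)"
        unfolding F_def by (intro DERIV_cdivide DERIV_mult DERIV_ident D)
      also have "(1 * arctan (u / s) + s / (u\<^sup>2 + s\<^sup>2) * u) / (2 * s ^ 3)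
          = arctan (u / s) / (2 * s ^ 3) + s / (u\<^sup>2 + s\<^sup>2) * u / (2 * s ^ 3)"
        by (simp add: add_divide_distrib)
      also have "s / (u\<^sup>2 + s\<^sup>2) * u / (2 * s ^ 3) = u / (2 * s\<^sup>2 * (u\<^sup>2 + s\<^sup>2))"
        using s by (simp add: power2_eq_square power3_eq_cube mult_ac)
      finally show ?thesis unfolding F'_def .
    qed
    show "DERIV F' u :> 1 / (u\<^sup>2 + s\<^sup>2)\<^sup>2" for u
    proof -
      have "DERIV F' u :> s / (u\<^sup>2 + s\<^sup>2) / (2 * s ^ 3)
          + (2 * s\<^sup>2 * (u\<^sup>2 + s\<^sup>2) - u * (2 * s\<^sup>2 * (2 * u))) / (2 * s\<^sup>2 * (u\<^sup>2 + s\<^sup>2))\<^sup>2"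
      proof -
        have "DERIV (\<lambda>u. u / (2 * s\<^sup>2 * (u\<^sup>2 + s\<^sup>2))) u :>
            (2 * s\<^sup>2 * (u\<^sup>2 + s\<^sup>2) - u * (2 * s\<^sup>2 * (2 * u))) / (2 * s\<^sup>2 * (u\<^sup>2 + s\<^sup>2))\<^sup>2"
          using s pos[of u] by (auto intro!: derivative_eq_intros simp: power2_eq_square)
        then show ?thesis
          unfolding F'_def by (intro DERIV_add DERIV_cdivide D)
      qed
      also have "s / (u\<^sup>2 + s\<^sup>2) / (2 * s ^ 3) = (u\<^sup>2 + s\<^sup>2) / (2 * s\<^sup>2 * (u\<^sup>2 + s\<^sup>2)\<^sup>2)"
        using s pos[of u] by (simp add: power2_eq_square power3_eq_cube)
      also have "(2 * s\<^sup>2 * (u\<^sup>2 + s\<^sup>2) - u * (2 * s\<^sup>2 * (2 * u))) / (2 * s\<^sup>2 * (u\<^sup>2 + s\<^sup>2))\<^sup>2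
          = (2 * s\<^sup>2 * (s\<^sup>2 - u\<^sup>2)) / (2 * s\<^sup>2 * (2 * s\<^sup>2 * (u\<^sup>2 + s\<^sup>2)\<^sup>2))"
        by (simp add: algebra_simps power2_eq_square)
      also have "\<dots> = (s\<^sup>2 - u\<^sup>2) / (2 * s\<^sup>2 * (u\<^sup>2 + s\<^sup>2)\<^sup>2)"
        using s by (intro nonzero_mult_divide_mult_cancel_left) simp
      also have "(u\<^sup>2 + s\<^sup>2) / (2 * s\<^sup>2 * (u\<^sup>2 + s\<^sup>2)\<^sup>2) + (s\<^sup>2 - u\<^sup>2) / (2 * s\<^sup>2 * (u\<^sup>2 + s\<^sup>2)\<^sup>2)
          = (2 * s\<^sup>2) * 1 / ((2 * s\<^sup>2) * (u\<^sup>2 + s\<^sup>2)\<^sup>2)"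
        by (simp flip: add_divide_distrib)
      also have "\<dots> = 1 / (u\<^sup>2 + s\<^sup>2)\<^sup>2"
        using s by (intro nonzero_mult_divide_mult_cancel_left) simp
      finally show ?thesis .
    qed
    show "F' \<in> borel_measurable borel"
      unfolding F'_def by measurable
  qed (use L in auto)
  also have "F L - 2 * F 0 + F (- L) = L * arctan (L / s) / s ^ 3"
    by (simp add: F_def arctan_minus)
  finally show ?thesis .
qed

text \<open>
  A second primitive of \<open>L arctan (L / s) / s\<^sup>3\<close> in the variable \<open>s\<close>, found by integrating by parts
  twice.
\<close>

definition int_K_sq_primitive :: "real \<Rightarrow> real \<Rightarrow> real" where
  "int_K_sq_primitive L s = L * arctan (L / s) / (2 * s) + s * arctan (s / L) / (2 * L)
    + ln s - ln (s\<^sup>2 + L\<^sup>2) / 2"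

text \<open>
  The second difference at the corner values \<open>2\<close>, \<open>1 + a\<close>, \<open>2 a\<close> of \<open>s = y + y'\<close> on the square
  \<open>[1, a]\<^sup>2\<close>; this is \<open>\<pi>\<^sup>2\<close> times the integral of \<open>\<bar>K\<bar>\<^sup>2\<close> over pairs of points in the window.
\<close>

definition int_K_sq :: "real \<Rightarrow> real \<Rightarrow> real" where
  "int_K_sq a L = int_K_sq_primitive L (2 * a) - 2 * int_K_sq_primitive L (1 + a) + int_K_sq_primitive L 2"

lemma nn_integral_eq_int_K_sq:
  assumes a: "a > 1" and L: "L > 0"
  shows "(\<integral>\<^sup>+y. (\<integral>\<^sup>+y'. ennreal (L * arctan (L / (y + y')) / (y + y') ^ 3) * indicator {1..a} y' \<partial>lborel)
          * indicator {1..a} y \<partial>lborel)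
      = ennreal (int_K_sq a L)"
    and "int_K_sq a L \<ge> 0"
proof -
  define F' where "F' = (\<lambda>s. - L * arctan (L / s) / (2 * s\<^sup>2) + 1 / (2 * s) + arctan (s / L) / (2 * L))"
  have D1: "DERIV (\<lambda>s. arctan (L / s)) s :> - L / (s\<^sup>2 + L\<^sup>2)" if "s > 0" for s
  proof -
    have "DERIV (\<lambda>s. arctan (L / s)) s :> inverse (1 + (L / s)\<^sup>2) * (- L / s\<^sup>2)"
      using that by (auto intro!: derivative_eq_intros simp: power2_eq_square)
    also have "inverse (1 + (L / s)\<^sup>2) * (- L / s\<^sup>2) = - L / (s\<^sup>2 + L\<^sup>2)"
      using that by (simp add: field_simps add_pos_pos)
    finally show ?thesis .
  qed
  have D2: "DERIV (\<lambda>s. arctan (s / L)) s :> L / (s\<^sup>2 + L\<^sup>2)" for s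
  proof -
    have "DERIV (\<lambda>s. arctan (s / L)) s :> inverse (1 + (s / L)\<^sup>2) * (1 / L)"
      using L by (auto intro!: derivative_eq_intros)
    also have "inverse (1 + (s / L)\<^sup>2) * (1 / L) = L / (s\<^sup>2 + L\<^sup>2)"
      using L by (simp add: divide_simps power2_eq_square)
    finally show ?thesis .
  qed
  have meas: "(\<lambda>s. L * arctan (L / s) / s ^ 3) \<in> borel_measurable borel" "F' \<in> borel_measurable borel"
    unfolding F'_def by measurable
  have derivs: "DERIV (int_K_sq_primitive L) s :> F' s" "DERIV F' s :> L * arctan (L / s) / s ^ 3"
      "0 \<le> L * arctan (L / s) / s ^ 3"
    if "s \<in> {2 * 1..2 * a}" for s
  proof -
    have s: "s > 0" using that by auto
    then have pos: "s\<^sup>2 + L\<^sup>2 > 0" using L by (simp add: add_pos_pos)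
    show "0 \<le> L * arctan (L / s) / s ^ 3" using L s by simp
    show "DERIV (int_K_sq_primitive L) s :> F' s"
      unfolding int_K_sq_primitive_def[abs_def] F'_def
      by ((rule D1 D2 derivative_eq_intros refl
          | use s L pos in \<open>simp add: power2_eq_square; fail\<close>)+,
          use s L pos in \<open>simp add: divide_simps\<close>,
          simp add: algebra_simps power2_eq_square power3_eq_cube power4_eq_xxxx)
    show "DERIV F' s :> L * arctan (L / s) / s ^ 3"
      unfolding F'_def
      by ((rule D1 D2 derivative_eq_intros refl
          | use s L pos in \<open>simp add: power2_eq_square; fail\<close>)+,
          use s L pos in \<open>simp add: divide_simps\<close>,
          simp add: algebra_simps power2_eq_square power3_eq_cube power4_eq_xxxx)
  qed
  have "1 \<le> a" using a by simp
  note second_difference = nn_integral_second_difference_sum[OF meas derivs this]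
  show "(\<integral>\<^sup>+y. (\<integral>\<^sup>+y'. ennreal (L * arctan (L / (y + y')) / (y + y') ^ 3) * indicator {1..a} y' \<partial>lborel)
          * indicator {1..a} y \<partial>lborel) = ennreal (int_K_sq a L)"
    and "int_K_sq a L \<ge> 0"
    using second_difference unfolding int_K_sq_def by simp_all
qed

text \<open>
  As \<open>L\<close> tends to infinity, the primitive is \<open>\<pi> L / (4 s) - 1 / 2 + ln s - ln L + o(1)\<close>.  Doubling
  removes the linear term, and taking the second difference in \<open>s\<close> removes everything that does not
  depend on \<open>s\<close>; only a second difference of \<open>- ln s\<close> survives.
\<close>

lemma int_K_sq_doubling_limit:
  assumes a: "a > 1"
  shows "((\<lambda>L. int_K_sq a (2 * L) - 2 * int_K_sq a L) \<longlongrightarrow> ln ((a + 1)\<^sup>2 / (4 * a))) at_top"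
proof -
  \<comment> \<open>Replacing \<open>L\<close> by \<open>2 L\<close> in \<open>ln (s\<^sup>2 + L\<^sup>2)\<close> produces the constant \<open>ln 4\<close>.\<close>
  have ln4: "ln 4 = 2 * ln (2 :: real)" using ln_realpow[of 2 2] by simp
  have *: "((\<lambda>L. int_K_sq_primitive (2 * L) s - 2 * int_K_sq_primitive L s - (ln L - ln 2)) \<longlongrightarrow> 1 / 2 - ln s) at_top"
    if "s > 0" for s
    unfolding int_K_sq_primitive_def using that ln4 by real_asymp
  have "((\<lambda>L. (int_K_sq_primitive (2 * L) (2 * a) - 2 * int_K_sq_primitive L (2 * a) - (ln L - ln 2))
      - 2 * (int_K_sq_primitive (2 * L) (1 + a) - 2 * int_K_sq_primitive L (1 + a) - (ln L - ln 2))
      + (int_K_sq_primitive (2 * L) 2 - 2 * int_K_sq_primitive L 2 - (ln L - ln 2)))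
      \<longlongrightarrow> (1 / 2 - ln (2 * a)) - 2 * (1 / 2 - ln (1 + a)) + (1 / 2 - ln 2)) at_top"
    using a by (intro tendsto_intros *) auto
  also have "(1 / 2 - ln (2 * a)) - 2 * (1 / 2 - ln (1 + a)) + (1 / 2 - ln 2) = ln ((a + 1)\<^sup>2 / (4 * a))"
    using a by (simp add: ln_div ln_mult ln_realpow ln4 add.commute)
  finally show ?thesis unfolding int_K_sq_def by (simp add: algebra_simps)
qed

lemma K_H_diag: "Im z > 0 \<Longrightarrow> K_H z z = of_real (1 / (4 * pi * (Im z)\<^sup>2))"
proof -
  have "z - cnj z = \<i> * of_real (2 * Im z)" by (simp add: complex_eq_iff)
  then show ?thesis by (simp add: K_H_def power_mult_distrib)
qed

lemma K_H_hermitian: "K_H w z = cnj (K_H z w)"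
proof -
  have "(w - cnj z)\<^sup>2 = (cnj z - w)\<^sup>2" by (rule power2_commute)
  then show ?thesis by (simp add: K_H_def)
qed

lemma norm_K_H_sq:
  "(norm (K_H z w))\<^sup>2 = 1 / (pi\<^sup>2 * ((Re z - Re w)\<^sup>2 + (Im z + Im w)\<^sup>2)\<^sup>2)"
proof -
  have "(norm (z - cnj w))\<^sup>2 = (Re z - Re w)\<^sup>2 + (Im z + Im w)\<^sup>2"
    by (simp add: cmod_power2)
  then show ?thesis
    by (simp add: K_H_def norm_divide norm_mult norm_power power_divide power_mult_distrib)
qed

text \<open>
  The two-by-two determinant of the kernel is nonnegative because \<open>4 y y' \<le> (y + y')\<^sup>2\<close>.  Hence the
  truncation in \<open>ennreal (Re _)\<close> does not affect the two-point correlation function.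
\<close>

lemma norm_K_H_sq_le:
  assumes "Im z > 0" "Im w > 0"
  shows "(norm (K_H z w))\<^sup>2 \<le> 1 / (4 * pi * (Im z)\<^sup>2) * (1 / (4 * pi * (Im w)\<^sup>2))"
proof -
  have "4 * Im z * Im w \<le> (Im z + Im w)\<^sup>2"
    using zero_le_power2[of "Im z - Im w"] by (simp add: power2_eq_square algebra_simps)
  also have "\<dots> \<le> (Re z - Re w)\<^sup>2 + (Im z + Im w)\<^sup>2" by simp
  finally have "(4 * Im z * Im w)\<^sup>2 \<le> ((Re z - Re w)\<^sup>2 + (Im z + Im w)\<^sup>2)\<^sup>2"
    using assms by (intro power_mono) auto
  then have "1 / (pi\<^sup>2 * ((Re z - Re w)\<^sup>2 + (Im z + Im w)\<^sup>2)\<^sup>2) \<le> 1 / (pi\<^sup>2 * (4 * Im z * Im w)\<^sup>2)"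
    using assms by (intro divide_left_mono mult_left_mono mult_pos_pos) (auto intro: add_nonneg_pos)
  then show ?thesis
    unfolding norm_K_H_sq by (simp add: power_mult_distrib power2_eq_square mult_ac)
qed

lemma measurable_K_H [measurable]:
  assumes [measurable]: "f \<in> borel_measurable N" "g \<in> borel_measurable N"
  shows "(\<lambda>x. K_H (f x) (g x)) \<in> borel_measurable N"
proof -
  have [measurable]: "(\<lambda>x. cnj (g x)) \<in> borel_measurable N"
    by (rule measurable_compose[OF assms(2)])
      (intro borel_measurable_continuous_onI continuous_intros)
  show ?thesis unfolding K_H_def by measurable
qed

lemma nn_integral_norm_K_H_sq:
  assumes a: "a > 1" and L: "L > 0"
  shows "(\<integral>\<^sup>+z. (\<integral>\<^sup>+w. ennreal ((norm (K_H z w))\<^sup>2) * indicator (box_in_H a L) w \<partial>lborel)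
      * indicator (box_in_H a L) z \<partial>lborel) = ennreal (1 / pi\<^sup>2) * ennreal (int_K_sq a L)"
proof -
  define k where "k = (\<lambda>z w. 1 / ((Re z - Re w)\<^sup>2 + (Im z + Im w)\<^sup>2)\<^sup>2)"
  have k [measurable]: "(\<lambda>x. k (g x) (h x)) \<in> borel_measurable N"
    if [measurable]: "g \<in> borel_measurable N" "h \<in> borel_measurable N" for g h and N :: "'n measure"
    unfolding k_def by measurable
  have K: "ennreal ((norm (K_H z w))\<^sup>2) = ennreal (1 / pi\<^sup>2) * ennreal (k z w)" for z w
    unfolding norm_K_H_sq k_def by (subst ennreal_mult[symmetric]) auto
  have "(\<integral>\<^sup>+z. (\<integral>\<^sup>+w. ennreal (k z w) * indicator (box_in_H a L) w \<partial>lborel) * indicator (box_in_H a L) z \<partial>lborel)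
      = (\<integral>\<^sup>+y. (\<integral>\<^sup>+y'. (\<integral>\<^sup>+x. (\<integral>\<^sup>+x'. ennreal (1 / ((x - x')\<^sup>2 + (y + y')\<^sup>2)\<^sup>2) * indicator {0..L} x' \<partial>lborel)
      * indicator {0..L} x \<partial>lborel) * indicator {1..a} y' \<partial>lborel) * indicator {1..a} y \<partial>lborel)"
    by (subst nn_integral_box_in_H_pair) (auto simp: k_def)
  also have "\<dots> = (\<integral>\<^sup>+y. (\<integral>\<^sup>+y'. ennreal (L * arctan (L / (y + y')) / (y + y') ^ 3) * indicator {1..a} y' \<partial>lborel)
          * indicator {1..a} y \<partial>lborel)"
  proof (rule nn_integral_cong)
    fix y :: real
    have "(\<integral>\<^sup>+y'. (\<integral>\<^sup>+x. (\<integral>\<^sup>+x'. ennreal (1 / ((x - x')\<^sup>2 + (y + y')\<^sup>2)\<^sup>2) * indicator {0..L} x' \<partial>lborel)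
        * indicator {0..L} x \<partial>lborel) * indicator {1..a} y' \<partial>lborel)
        = (\<integral>\<^sup>+y'. ennreal (L * arctan (L / (y + y')) / (y + y') ^ 3) * indicator {1..a} y' \<partial>lborel)"
      if y: "y \<in> {1..a}"
    proof (rule nn_integral_cong)
      fix y' :: real
      show "(\<integral>\<^sup>+x. (\<integral>\<^sup>+x'. ennreal (1 / ((x - x')\<^sup>2 + (y + y')\<^sup>2)\<^sup>2) * indicator {0..L} x' \<partial>lborel)
          * indicator {0..L} x \<partial>lborel) * indicator {1..a} y'
          = ennreal (L * arctan (L / (y + y')) / (y + y') ^ 3) * indicator {1..a} y'"
        using nn_integral_inverse_square_kernel[of "y + y'" L] L y by (cases "y' \<in> {1..a}") auto
    qed
    then show "(\<integral>\<^sup>+y'. (\<integral>\<^sup>+x. (\<integral>\<^sup>+x'. ennreal (1 / ((x - x')\<^sup>2 + (y + y')\<^sup>2)\<^sup>2) * indicator {0..L} x' \<partial>lborel)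
        * indicator {0..L} x \<partial>lborel) * indicator {1..a} y' \<partial>lborel) * indicator {1..a} y
        = (\<integral>\<^sup>+y'. ennreal (L * arctan (L / (y + y')) / (y + y') ^ 3) * indicator {1..a} y' \<partial>lborel) * indicator {1..a} y"
      by (cases "y \<in> {1..a}") auto
  qed
  also have "\<dots> = ennreal (int_K_sq a L)"
    by (rule nn_integral_eq_int_K_sq(1)[OF a L])
  finally have *: "(\<integral>\<^sup>+z. (\<integral>\<^sup>+w. ennreal (k z w) * indicator (box_in_H a L) w \<partial>lborel)
      * indicator (box_in_H a L) z \<partial>lborel) = ennreal (int_K_sq a L)" .
  show ?thesis
    unfolding K mult.assoc *[symmetric] by (simp add: nn_integral_cmult mult.assoc)
qed

lemma nn_integral_K_H_diag:
  assumes a: "a > 1" and L: "L > 0"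
  shows "(\<integral>\<^sup>+z. ennreal (Re (K_H z z)) * indicator (box_in_H a L) z \<partial>lborel)
    = ennreal (L * (1 - 1 / a) / (4 * pi))"
proof -
  have "(\<integral>\<^sup>+z. ennreal (Re (K_H z z)) * indicator (box_in_H a L) z \<partial>lborel)
      = (\<integral>\<^sup>+z. ennreal (1 / (4 * pi * (Im z)\<^sup>2)) * indicator (box_in_H a L) z \<partial>lborel)"
    by (intro nn_integral_cong) (auto simp: indicator_def box_in_H_def K_H_diag)
  also have "\<dots> = (\<integral>\<^sup>+y. (\<integral>\<^sup>+x. ennreal (1 / (4 * pi * y\<^sup>2)) * indicator {0..L} x \<partial>lborel) * indicator {1..a} y \<partial>lborel)"
    by (subst nn_integral_box_in_H) auto
  also have "\<dots> = (\<integral>\<^sup>+y. ennreal (L / (4 * pi * y\<^sup>2)) * indicator {1..a} y \<partial>lborel)"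
    using L by (simp add: nn_integral_cmult_indicator ennreal_mult[symmetric])
  also have "\<dots> = ennreal (- L / (4 * pi * a) - (- L / (4 * pi * 1)))"
  proof (rule nn_integral_FTC_Icc[where F = "\<lambda>y. - L / (4 * pi * y)"])
    show "DERIV (\<lambda>y. - L / (4 * pi * y)) y :> L / (4 * pi * y\<^sup>2)" if "y \<in> {1..a}" for y
      using that by (auto intro!: derivative_eq_intros simp: power2_eq_square field_simps)
  qed (use a L in auto)
  also have "- L / (4 * pi * a) - (- L / (4 * pi * 1)) = L * (1 - 1 / a) / (4 * pi)"
    using a by (simp add: field_simps)
  finally show ?thesis .
qed

section \<open>Mean and variance of the number of points in a window\<close>

lemma det_2x2:
  fixes A :: "'a :: comm_ring_1 mat"
  assumes "A \<in> carrier_mat 2 2"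
  shows "Determinant.det A = A $$ (0, 0) * A $$ (1, 1) - A $$ (0, 1) * A $$ (1, 0)"
proof -
  have [simp]: "Determinant.det (mat_delete A 0 i) = mat_delete A 0 i $$ (0, 0)" for i
    using assms by (intro det_single) (auto simp: mat_delete_def)
  have "Determinant.det A = (\<Sum>j<2. A $$ (0, j) * cofactor A 0 j)"
    using assms by (intro laplace_expansion_row) auto
  also have "\<dots> = A $$ (0, 0) * cofactor A 0 0 + A $$ (0, 1) * cofactor A 0 1"
    by (simp add: numeral_2_eq_2 lessThan_Suc)
  also have "\<dots> = A $$ (0, 0) * mat_delete A 0 0 $$ (0, 0) - A $$ (0, 1) * mat_delete A 0 1 $$ (0, 0)"
    by (simp add: cofactor_def)
  finally show ?thesis
    using assms by (simp add: mat_delete_def)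
qed

text \<open>
  The integrand is the indicator function of the injective tuples with all entries in \<open>B\<close>, and the
  number of these is a falling factorial.  In this way the defining property of correlation functions
  becomes a statement about factorial moments.
\<close>

lemma nn_integral_count_space_inj_tuples:
  assumes fin: "finite (A \<inter> B)"
  shows "(\<integral>\<^sup>+x. (\<Prod>i<n. indicator B (x i)) \<partial>count_space {x \<in> {..<n} \<rightarrow>\<^sub>E A. inj_on x {..<n}})
    = of_nat (\<Prod>i<n. card (A \<inter> B) - i)"
proof -
  let ?X = "{x \<in> {..<n} \<rightarrow>\<^sub>E A. inj_on x {..<n}}"
  let ?Y = "{x \<in> {..<n} \<rightarrow>\<^sub>E A \<inter> B. inj_on x {..<n}}"
  have "(\<integral>\<^sup>+x. (\<Prod>i<n. indicator B (x i)) \<partial>count_space ?X) = (\<integral>\<^sup>+x. indicator ?Y x \<partial>count_space ?X)"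
  proof (rule nn_integral_cong)
    fix x assume "x \<in> space (count_space ?X)"
    then have x: "x \<in> ?X" by simp
    show "(\<Prod>i<n. indicator B (x i)) = (indicator ?Y x :: ennreal)"
    proof (cases "\<forall>i<n. x i \<in> B")
      case True
      then have "x \<in> ?Y" using x by (simp add: PiE_iff)
      then show ?thesis using True by simp
    next
      case False
      then obtain i where i: "i < n" "x i \<notin> B" by blast
      then have "x \<notin> ?Y" by (simp add: PiE_iff) blast
      moreover have "(\<Prod>i<n. indicator B (x i)) = (0 :: ennreal)"
        using i by (intro prod_zero bexI[of _ i]) auto
      ultimately show ?thesis by simp
    qed
  qed
  also have "\<dots> = emeasure (count_space ?X) ?Y"
    by (rule nn_integral_indicator) auto
  also have "\<dots> = of_nat (card ?Y)"
  proof -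
    have "finite ?Y"
      by (rule finite_subset[of _ "{..<n} \<rightarrow>\<^sub>E A \<inter> B"]) (simp_all add: finite_PiE fin)
    moreover have "?Y \<subseteq> ?X" by (intro Collect_mono) (simp add: PiE_iff)
    ultimately show ?thesis by (intro emeasure_count_space_finite)
  qed
  also have "card ?Y = (\<Prod>i<n. card (A \<inter> B) - i)"
    unfolding card_inj_on_subset_funcset[OF finite_lessThan fin order_refl]
    by (simp add: atLeast0LessThan)
  finally show ?thesis .
qed

context determinantal_point_process
begin

lemma factorial_moment_correlation:
  assumes S: "S \<in> sets borel" and B: "compact B" "B \<subseteq> S"
  shows "(\<integral>\<^sup>+\<omega>. of_nat (\<Prod>i<n. card (Z \<omega> \<inter> B) - i) \<partial>M) =
    (\<integral>\<^sup>+x. (\<Prod>i<n. indicator B (x i)) *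
        ennreal (Re (Determinant.det (mat n n (\<lambda>(i, j). K (x i) (x j)))))
      \<partial>Pi\<^sub>M {..<n} (\<lambda>_. restrict_space lborel S))"
proof -
  have [measurable]: "B \<in> sets (restrict_space lborel S)"
    using B S by (auto simp: sets_restrict_space_iff borel_compact)
  have "(\<integral>\<^sup>+\<omega>. of_nat (\<Prod>i<n. card (Z \<omega> \<inter> B) - i) \<partial>M) =
      (\<integral>\<^sup>+\<omega>. (\<integral>\<^sup>+x. (\<Prod>i<n. indicator B (x i))
        \<partial>count_space {x \<in> {..<n} \<rightarrow>\<^sub>E Z \<omega>. inj_on x {..<n}}) \<partial>M)"
    using locally_finite B
    by (intro nn_integral_cong nn_integral_count_space_inj_tuples[symmetric]) auto
  also have "\<dots> = (\<integral>\<^sup>+x. (\<Prod>i<n. indicator B (x i)) *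
        ennreal (Re (Determinant.det (mat n n (\<lambda>(i, j). K (x i) (x j)))))
      \<partial>Pi\<^sub>M {..<n} (\<lambda>_. restrict_space lborel S))"
    by (rule correlation) measurable
  finally show ?thesis .
qed

lemma factorial_moment_1:
  assumes S: "S \<in> sets borel" and B: "compact B" "B \<subseteq> S"
    and K: "(\<lambda>z. K z z) \<in> borel_measurable (borel :: complex measure)"
  shows "(\<integral>\<^sup>+\<omega>. of_nat (card (Z \<omega> \<inter> B)) \<partial>M) =
    (\<integral>\<^sup>+z. ennreal (Re (K z z)) * indicator B z \<partial>lborel)"
proof -
  interpret R: sigma_finite_measure "restrict_space lborel S"
    using S by (intro sigma_finite_measure_restrict_space lborel.sigma_finite_measure_axioms) simp
  interpret P: product_sigma_finite "\<lambda>_ :: nat. restrict_space lborel S"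
    by standard
  have [measurable]: "B \<in> sets (restrict_space lborel S)"
    using B S by (auto simp: sets_restrict_space_iff borel_compact)
  have [measurable]: "(\<lambda>z. K z z) \<in> borel_measurable (restrict_space lborel S)"
    using K by (intro measurable_restrict_space1) simp
  have 1: "{..<1::nat} = {0}" by auto
  have "(\<integral>\<^sup>+\<omega>. of_nat (card (Z \<omega> \<inter> B)) \<partial>M) = (\<integral>\<^sup>+\<omega>. of_nat (\<Prod>i<1. card (Z \<omega> \<inter> B) - i) \<partial>M)"
    by simp
  also have "\<dots> = (\<integral>\<^sup>+x. (\<lambda>z. indicator B z * ennreal (Re (K z z))) (x 0)
      \<partial>Pi\<^sub>M {0} (\<lambda>_ :: nat. restrict_space lborel S))"
    unfolding factorial_moment_correlation[OF S B] unfolding 1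
    by (simp add: det_single[of "mat (Suc 0) (Suc 0) _"])
  also have "\<dots> = (\<integral>\<^sup>+z. indicator B z * ennreal (Re (K z z)) \<partial>restrict_space lborel S)"
    by (rule P.product_nn_integral_singleton) measurable
  also have "\<dots> = (\<integral>\<^sup>+z. indicator B z * ennreal (Re (K z z)) * indicator S z \<partial>lborel)"
    using S by (intro nn_integral_restrict_space) simp
  also have "\<dots> = (\<integral>\<^sup>+z. ennreal (Re (K z z)) * indicator B z \<partial>lborel)"
    using B(2) by (intro nn_integral_cong) (auto simp: indicator_def)
  finally show ?thesis .
qed

lemma factorial_moment_2:
  assumes S: "S \<in> sets borel" and B: "compact B" "B \<subseteq> S"
    and K: "case_prod K \<in> borel_measurable (borel \<Otimes>\<^sub>M borel)"
  shows "(\<integral>\<^sup>+\<omega>. of_nat (card (Z \<omega> \<inter> B) * (card (Z \<omega> \<inter> B) - 1)) \<partial>M) =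
    (\<integral>\<^sup>+z. (\<integral>\<^sup>+w. ennreal (Re (K z z * K w w - K z w * K w z)) * indicator B w \<partial>lborel)
      * indicator B z \<partial>lborel)"
proof -
  let ?R = "restrict_space lborel S"
  interpret R: sigma_finite_measure ?R
    using S by (intro sigma_finite_measure_restrict_space lborel.sigma_finite_measure_axioms) simp
  interpret P: product_sigma_finite "\<lambda>_ :: nat. ?R"
    by standard
  have [measurable]: "B \<in> sets ?R"
    using B S by (auto simp: sets_restrict_space_iff borel_compact)
  have [measurable]: "B \<in> sets borel" using B by (simp add: borel_compact)
  have K' [measurable]: "(\<lambda>x. K (f x) (g x)) \<in> borel_measurable N"
    if [measurable]: "f \<in> borel_measurable N" "g \<in> borel_measurable N" for f g and N :: "'n measure"
    using measurable_compose[OF measurable_Pair K, of f N g] that by simp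
  have id [measurable]: "(\<lambda>z. z) \<in> borel_measurable ?R"
    by (rule measurable_restrict_space1) simp
  have 2: "{..<2::nat} = {0, 1}" by auto
  define D where "D = (\<lambda>z w. ennreal (Re (K z z * K w w - K z w * K w z)))"
  have "(\<integral>\<^sup>+\<omega>. of_nat (card (Z \<omega> \<inter> B) * (card (Z \<omega> \<inter> B) - 1)) \<partial>M)
      = (\<integral>\<^sup>+\<omega>. of_nat (\<Prod>i<2. card (Z \<omega> \<inter> B) - i) \<partial>M)"
    by (simp add: 2)
  also have "\<dots> = (\<integral>\<^sup>+x. (\<lambda>z w. D z w * indicator B w * indicator B z) (x 0) (x 1) \<partial>Pi\<^sub>M {0, 1} (\<lambda>_ :: nat. ?R))"
    unfolding factorial_moment_correlation[OF S B] unfolding 2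
    by (simp add: det_2x2 D_def mult_ac)
  also have "\<dots> = (\<integral>\<^sup>+p. (\<lambda>z w. D z w * indicator B w * indicator B z) (fst p) (snd p) \<partial>(?R \<Otimes>\<^sub>M ?R))"
  proof (rule P.product_nn_integral_pair)
    have [measurable]: "fst \<in> borel_measurable (?R \<Otimes>\<^sub>M ?R)" "snd \<in> borel_measurable (?R \<Otimes>\<^sub>M ?R)"
      using measurable_compose[OF measurable_fst id] measurable_compose[OF measurable_snd id] by auto
    show "(\<lambda>(z, w). D z w * indicator B w * indicator B z) \<in> borel_measurable (?R \<Otimes>\<^sub>M ?R)"
      unfolding D_def case_prod_unfold by measurable
  qed simp
  also have "\<dots> = (\<integral>\<^sup>+z. (\<integral>\<^sup>+w. D z w * indicator B w * indicator B z \<partial>?R) \<partial>?R)"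
  proof -
    have [measurable]: "fst \<in> borel_measurable (?R \<Otimes>\<^sub>M ?R)" "snd \<in> borel_measurable (?R \<Otimes>\<^sub>M ?R)"
      using measurable_compose[OF measurable_fst id] measurable_compose[OF measurable_snd id] by auto
    have "(\<lambda>p. D (fst p) (snd p) * indicator B (snd p) * indicator B (fst p)) \<in> borel_measurable (?R \<Otimes>\<^sub>M ?R)"
      unfolding D_def by measurable
    from R.nn_integral_fst[OF this] show ?thesis by simp
  qed
  also have "\<dots> = (\<integral>\<^sup>+z. (\<integral>\<^sup>+w. D z w * indicator B w * indicator B z * indicator S w \<partial>lborel) * indicator S z \<partial>lborel)"
    using S by (simp add: nn_integral_restrict_space)
  also have "\<dots> = (\<integral>\<^sup>+z. (\<integral>\<^sup>+w. D z w * indicator B w \<partial>lborel) * indicator B z \<partial>lborel)"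
  proof (rule nn_integral_cong)
    fix z
    have "(\<integral>\<^sup>+w. D z w * indicator B w * indicator B z * indicator S w \<partial>lborel)
        = (\<integral>\<^sup>+w. D z w * indicator B w * indicator B z \<partial>lborel)"
      using B(2) by (intro nn_integral_cong) (auto simp: indicator_def)
    then show "(\<integral>\<^sup>+w. D z w * indicator B w * indicator B z * indicator S w \<partial>lborel) * indicator S z
        = (\<integral>\<^sup>+w. D z w * indicator B w \<partial>lborel) * indicator B z"
      using B(2) by (cases "z \<in> B") auto
  qed
  finally show ?thesis by (simp add: D_def)
qed

end

lemma count_N_eq_card: "count_N Z a L \<omega> = card (Z \<omega> \<inter> box_in_H a L)"
  unfolding count_N_def box_in_H_def by (rule arg_cong[where f = card]) auto

context simple_point_process
begin

lemma measurable_count_N: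
  assumes "S = upper_half_plane"
  shows "count_N Z a L \<in> measurable M (count_space UNIV)"
  using count_measurable[OF compact_box_in_H _ borel_box_in_H order_refl] box_in_H_subset
  unfolding count_N_eq_card[abs_def] assms by blast

end

text \<open>
  The second factorial moment is the integral of \<open>K(z,z) K(w,w) - \<bar>K(z,w)\<bar>\<^sup>2\<close>, that is, the square of the
  mean minus the integral of \<open>\<bar>K\<bar>\<^sup>2\<close>.
\<close>

lemma mean_variance_count_N:
  assumes dpp: "determinantal_point_process M Z upper_half_plane K_H"
    and a: "a > 1" and L: "L > 0"
    and int: "integrable M (\<lambda>\<omega>. real (count_N Z a L \<omega>))"
      "integrable M (\<lambda>\<omega>. (real (count_N Z a L \<omega>))\<^sup>2)"
  shows "prob_space.expectation M (\<lambda>\<omega>. real (count_N Z a L \<omega>)) = L * (1 - 1 / a) / (4 * pi)" (is "?E = ?m")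
    and "prob_space.variance M (\<lambda>\<omega>. real (count_N Z a L \<omega>))
      = L * (1 - 1 / a) / (4 * pi) - int_K_sq a L / pi\<^sup>2"
proof -
  interpret determinantal_point_process M Z upper_half_plane K_H by (rule dpp)
  let ?N = "\<lambda>\<omega>. real (count_N Z a L \<omega>)"
  let ?B = "box_in_H a L"
  have S: "upper_half_plane \<in> sets borel"
    unfolding upper_half_plane_def by (intro borel_open open_halfspace_Im_gt)
  have m: "?m \<ge> 0" using a L by simp
  have K2: "case_prod K_H \<in> borel_measurable (borel \<Otimes>\<^sub>M borel)"
    unfolding case_prod_unfold by measurable
  have nn1: "(\<integral>\<^sup>+\<omega>. ennreal (?N \<omega>) \<partial>M) = ennreal ?m"
    using factorial_moment_1[OF S compact_box_in_H box_in_H_subset, of a L] nn_integral_K_H_diag[OF a L]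
    by (simp add: count_N_eq_card ennreal_of_nat_eq_real_of_nat)
  then show E: "?E = ?m"
    using m int(1) by (subst (asm) nn_integral_eq_integral) (auto simp: integral_nonneg_AE)
  define D where "D = (\<lambda>z w. Re (K_H z z * K_H w w - K_H z w * K_H w z))"
  \<comment> \<open>The identity is kept additive, because subtraction on \<open>ennreal\<close> is truncated.\<close>
  have D: "ennreal (D z w) + ennreal ((norm (K_H z w))\<^sup>2)
      = ennreal (Re (K_H z z)) * ennreal (Re (K_H w w))"
    if "z \<in> ?B" "w \<in> ?B" for z w
  proof -
    have pos: "Im z > 0" "Im w > 0" using that by (auto simp: box_in_H_def)
    have "K_H z w * K_H w z = of_real ((norm (K_H z w))\<^sup>2)"
      using complex_norm_square[of "K_H z w"] by (simp add: K_H_hermitian[of w z])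
    moreover have "Re (K_H z z * K_H w w) = Re (K_H z z) * Re (K_H w w)"
      using pos by (simp add: K_H_diag)
    ultimately have "D z w = Re (K_H z z) * Re (K_H w w) - (norm (K_H z w))\<^sup>2"
      by (simp only: D_def minus_complex.sel Re_complex_of_real)
    moreover have "(norm (K_H z w))\<^sup>2 \<le> Re (K_H z z) * Re (K_H w w)"
      using norm_K_H_sq_le[OF pos] pos by (simp add: K_H_diag)
    moreover have "Re (K_H z z) \<ge> 0" "Re (K_H w w) \<ge> 0" using pos by (simp_all add: K_H_diag)
    ultimately show ?thesis
      by (simp flip: ennreal_plus ennreal_mult)
  qed
  define P where "P = (\<integral>\<^sup>+z. (\<integral>\<^sup>+w. ennreal (D z w) * indicator ?B w \<partial>lborel) * indicator ?B z \<partial>lborel)"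
  have D_meas [measurable]: "(\<lambda>x. D (g x) (h x)) \<in> borel_measurable N"
    if [measurable]: "g \<in> borel_measurable N" "h \<in> borel_measurable N" for g h and N :: "'n measure"
    unfolding D_def by measurable
  have sum: "P + ennreal (1 / pi\<^sup>2) * ennreal (int_K_sq a L) = ennreal ?m * ennreal ?m"
  proof -
    have "P + ennreal (1 / pi\<^sup>2) * ennreal (int_K_sq a L)
        = (\<integral>\<^sup>+z. (\<integral>\<^sup>+w. ennreal (D z w) * indicator ?B w \<partial>lborel) * indicator ?B z
            + (\<integral>\<^sup>+w. ennreal ((norm (K_H z w))\<^sup>2) * indicator ?B w \<partial>lborel) * indicator ?B z \<partial>lborel)"
      unfolding P_def nn_integral_norm_K_H_sq[OF a L, symmetric]
      by (rule nn_integral_add[symmetric]) measurable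
    also have "\<dots> = (\<integral>\<^sup>+z. ennreal ?m * (ennreal (Re (K_H z z)) * indicator ?B z) \<partial>lborel)"
    proof (rule nn_integral_cong)
      fix z
      have "(\<integral>\<^sup>+w. ennreal (D z w) * indicator ?B w \<partial>lborel)
            + (\<integral>\<^sup>+w. ennreal ((norm (K_H z w))\<^sup>2) * indicator ?B w \<partial>lborel)
          = ennreal ?m * ennreal (Re (K_H z z))" if z: "z \<in> ?B"
      proof -
        have "(\<integral>\<^sup>+w. ennreal (D z w) * indicator ?B w \<partial>lborel)
            + (\<integral>\<^sup>+w. ennreal ((norm (K_H z w))\<^sup>2) * indicator ?B w \<partial>lborel)
          = (\<integral>\<^sup>+w. ennreal (D z w) * indicator ?B w
              + ennreal ((norm (K_H z w))\<^sup>2) * indicator ?B w \<partial>lborel)"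
          by (rule nn_integral_add[symmetric]) measurable
        also have "\<dots> = (\<integral>\<^sup>+w. ennreal (Re (K_H z z)) * (ennreal (Re (K_H w w)) * indicator ?B w) \<partial>lborel)"
          by (intro nn_integral_cong) (auto simp: indicator_def D[OF z])
        also have "\<dots> = ennreal (Re (K_H z z)) * ennreal ?m"
          unfolding nn_integral_K_H_diag[OF a L, symmetric] by (rule nn_integral_cmult) measurable
        finally show ?thesis by (simp add: mult.commute)
      qed
      then show "(\<integral>\<^sup>+w. ennreal (D z w) * indicator ?B w \<partial>lborel) * indicator ?B z
            + (\<integral>\<^sup>+w. ennreal ((norm (K_H z w))\<^sup>2) * indicator ?B w \<partial>lborel) * indicator ?B z
          = ennreal ?m * (ennreal (Re (K_H z z)) * indicator ?B z)"
        by (cases "z \<in> ?B") auto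
    qed
    also have "\<dots> = ennreal ?m * ennreal ?m"
      by (subst nn_integral_cmult) (use nn_integral_K_H_diag[OF a L] in auto)
    finally show ?thesis .
  qed
  have nn2: "(\<integral>\<^sup>+\<omega>. ennreal ((?N \<omega>)\<^sup>2 - ?N \<omega>) \<partial>M) = P"
  proof -
    have "(\<integral>\<^sup>+\<omega>. ennreal ((?N \<omega>)\<^sup>2 - ?N \<omega>) \<partial>M)
        = (\<integral>\<^sup>+\<omega>. of_nat (card (Z \<omega> \<inter> ?B) * (card (Z \<omega> \<inter> ?B) - 1)) \<partial>M)"
    proof (rule nn_integral_cong)
      fix \<omega>
      have "real (n * (n - 1)) = (real n)\<^sup>2 - real n" for n
        by (cases n) (auto simp: power2_eq_square algebra_simps)
      then show "ennreal ((?N \<omega>)\<^sup>2 - ?N \<omega>) = of_nat (card (Z \<omega> \<inter> ?B) * (card (Z \<omega> \<inter> ?B) - 1))"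
        unfolding count_N_eq_card ennreal_of_nat_eq_real_of_nat by simp
    qed
    also have "\<dots> = P"
      unfolding P_def D_def by (rule factorial_moment_2[OF S compact_box_in_H box_in_H_subset K2])
    finally show ?thesis .
  qed
  have le: "?N \<omega> \<le> (?N \<omega>)\<^sup>2" for \<omega>
    using le_square[of "count_N Z a L \<omega>"] by (simp add: power2_eq_square flip: of_nat_mult)
  have nonneg: "AE \<omega> in M. 0 \<le> (?N \<omega>)\<^sup>2 - ?N \<omega>"
    by (rule AE_I2) (simp only: diff_ge_0_iff_ge le)
  have "integrable M (\<lambda>\<omega>. (?N \<omega>)\<^sup>2 - ?N \<omega>)"
    using int by (intro Bochner_Integration.integrable_diff)
  then have "P = ennreal (expectation (\<lambda>\<omega>. (?N \<omega>)\<^sup>2 - ?N \<omega>))"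
    unfolding nn2[symmetric] using nonneg by (rule nn_integral_eq_integral)
  moreover have "expectation (\<lambda>\<omega>. (?N \<omega>)\<^sup>2 - ?N \<omega>) \<ge> 0"
    using nonneg by (rule integral_nonneg_AE)
  ultimately have P: "P = ennreal (expectation (\<lambda>\<omega>. (?N \<omega>)\<^sup>2) - ?m)"
    and nonneg: "expectation (\<lambda>\<omega>. (?N \<omega>)\<^sup>2) - ?m \<ge> 0"
    using int E by simp_all
  have J: "int_K_sq a L \<ge> 0" by (rule nn_integral_eq_int_K_sq(2)[OF a L])
  have "ennreal ((expectation (\<lambda>\<omega>. (?N \<omega>)\<^sup>2) - ?m) + 1 / pi\<^sup>2 * int_K_sq a L)
      = P + ennreal (1 / pi\<^sup>2) * ennreal (int_K_sq a L)"
    unfolding P by (subst ennreal_plus[OF nonneg]) (use J in \<open>auto simp: ennreal_mult[symmetric]\<close>)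
  also have "\<dots> = ennreal (?m * ?m)"
    unfolding sum by (rule ennreal_mult[OF m m, symmetric])
  finally have "(expectation (\<lambda>\<omega>. (?N \<omega>)\<^sup>2) - ?m) + 1 / pi\<^sup>2 * int_K_sq a L = ?m * ?m"
    by (subst (asm) ennreal_inj) (use nonneg J m in auto)
  moreover have V: "variance ?N = expectation (\<lambda>\<omega>. (?N \<omega>)\<^sup>2) - ?m * ?m"
    using variance_eq[OF int] by (simp only: E power2_eq_square[of ?m])
  ultimately show "variance ?N = ?m - int_K_sq a L / pi\<^sup>2"
    unfolding V by simp
qed

section \<open>The strong Szego correction at the origin\<close>

text \<open>
  Taylor's theorem, with the third derivative bounded on a compact disc around \<open>0\<close>.
\<close>

lemma cubic_remainder_bigo:
  assumes f: "f holomorphic_on S" and S: "open S" "0 \<in> S"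
    and f0: "f 0 = 0" "deriv f 0 = 0"
  shows "(\<lambda>\<theta>. f \<theta> - (deriv ^^ 2) f 0 / 2 * \<theta>\<^sup>2) \<in> O[at 0 within T](\<lambda>\<theta>. complex_of_real (norm \<theta> ^ 3))"
proof -
  obtain r where r: "r > 0" "cball 0 r \<subseteq> S" using S open_contains_cball by blast
  have hol: "(deriv ^^ k) f holomorphic_on S" for k using f S holomorphic_higher_deriv by blast
  have "continuous_on (cball 0 r) ((deriv ^^ 3) f)"
    using hol[THEN holomorphic_on_imp_continuous_on] r continuous_on_subset by blast
  then have "bounded ((deriv ^^ 3) f ` cball 0 r)"
    by (intro compact_imp_bounded compact_continuous_image) auto
  then obtain B where B: "\<And>w. w \<in> cball 0 r \<Longrightarrow> norm ((deriv ^^ 3) f w) \<le> B"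
    unfolding bounded_iff by blast
  have bound: "norm (f \<theta> - (deriv ^^ 2) f 0 / 2 * \<theta>\<^sup>2) \<le> B / 2 * norm (complex_of_real (norm \<theta> ^ 3))"
    if "\<theta> \<in> cball 0 r" for \<theta>
  proof -
    have "cmod ((deriv ^^ 0) f \<theta> - (\<Sum>i\<le>2. (deriv ^^ i) f 0 * (\<theta> - 0) ^ i / fact i))
        \<le> B * cmod (\<theta> - 0) ^ Suc 2 / fact 2"
    proof (rule complex_Taylor)
      show "((deriv ^^ i) f has_field_derivative (deriv ^^ Suc i) f w) (at w within cball 0 r)"
        if "w \<in> cball 0 r" for i w
        using holomorphic_derivI[OF hol S(1), of w i] that r
        by (auto intro: has_field_derivative_at_within)
      show "cmod ((deriv ^^ Suc 2) f w) \<le> B" if "w \<in> cball 0 r" for w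
        using B[OF that] by (simp add: eval_nat_numeral)
    qed (use that r in auto)
    then show ?thesis
      using f0 by (simp add: eval_nat_numeral norm_mult norm_power)
  qed
  show ?thesis
  proof (rule bigoI)
    have "eventually (\<lambda>\<theta>. \<theta> \<in> ball 0 r) (at 0 within T)"
      using r eventually_at_ball'[of r 0 T] by (auto elim!: eventually_mono)
    then show "eventually (\<lambda>\<theta>. norm (f \<theta> - (deriv ^^ 2) f 0 / 2 * \<theta>\<^sup>2)
        \<le> B / 2 * norm (complex_of_real (norm \<theta> ^ 3))) (at 0 within T)"
      by eventually_elim (use bound in auto)
  qed
qed

text \<open>
  Doubling the length of the window eliminates the leading term: with \<open>h L = g L - L \<Lambda>\<close> one has
  \<open>2 g L - g (2 L) = 2 h L - h (2 L)\<close>, and both \<open>h L\<close> and \<open>h (2 L)\<close> converge to \<open>C\<close>.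
\<close>

lemma szego_correction_eq_limit:
  assumes "is_szego_correction M Z a C"
  obtains g :: "real \<Rightarrow> complex \<Rightarrow> complex" where
    "\<And>L. L > 0 \<Longrightarrow> is_log_branch
      (\<lambda>\<theta>. prob_space.expectation M (\<lambda>\<omega>. exp (\<theta> * of_nat (count_N Z a L \<omega>)))) (g L)"
    and "uniform_limit (cball 0 1) (\<lambda>L \<theta>. 2 * g L \<theta> - g (2 * L) \<theta>) C at_top"
proof -
  from assms obtain g where
    g: "\<forall>L>0. is_log_branch
        (\<lambda>\<theta>. prob_space.expectation M (\<lambda>\<omega>. exp (\<theta> * of_nat (count_N Z a L \<omega>)))) (g L)" and
    lim: "\<forall>D. compact D \<longrightarrow> D \<subseteq> strip pi \<longrightarrow>
        uniform_limit D (\<lambda>L \<theta>. g L \<theta> - of_real L * Lambda a \<theta>) C at_top"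
    unfolding is_szego_correction_def by blast
  have sub: "cball 0 1 \<subseteq> strip pi" using pi_gt3 by (intro cball_subset_strip) linarith
  have h: "uniform_limit (cball 0 1) (\<lambda>L \<theta>. g L \<theta> - of_real L * Lambda a \<theta>) C at_top"
    by (rule lim[rule_format, OF compact_cball sub])
  have "filterlim (\<lambda>L :: real. 2 * L) at_top at_top" by real_asymp
  from filterlim_compose[OF h this]
  have h2: "uniform_limit (cball 0 1) (\<lambda>L \<theta>. g (2 * L) \<theta> - of_real (2 * L) * Lambda a \<theta>) C at_top" .
  have "uniform_limit (cball 0 1)
      (\<lambda>L \<theta>. (g L \<theta> - of_real L * Lambda a \<theta>) + (g L \<theta> - of_real L * Lambda a \<theta>)
        - (g (2 * L) \<theta> - of_real (2 * L) * Lambda a \<theta>)) (\<lambda>\<theta>. C \<theta> + C \<theta> - C \<theta>) at_top"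
    by (intro uniform_limit_intros h h2)
  then have "uniform_limit (cball 0 1) (\<lambda>L \<theta>. 2 * g L \<theta> - g (2 * L) \<theta>) C at_top"
    by (simp add: algebra_simps)
  then show ?thesis using g by (intro that) auto
qed

theorem proposition6p11:
  fixes M :: "'w measure" and Z :: "'w \<Rightarrow> complex set" and a :: real
    and C :: "complex \<Rightarrow> complex"
  assumes "determinantal_point_process M Z upper_half_plane K_H"
    and "a > 1"
    and "is_szego_correction M Z a C"
  shows "C 0 = 0 \<and> deriv C 0 = 0 \<and>
      (deriv ^^ 2) C 0 = complex_of_real (1 / pi\<^sup>2 * ln ((a + 1)\<^sup>2 / (4 * a))) \<and>
      (\<forall>\<theta>s. 0 < \<theta>s \<and> \<theta>s < pi \<longrightarrow>
        (\<lambda>\<theta>. C \<theta> - complex_of_real (1 / (2 * pi\<^sup>2) * ln ((a + 1)\<^sup>2 / (4 * a))) * \<theta>\<^sup>2)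
          \<in> O[at 0 within strip \<theta>s](\<lambda>\<theta>. complex_of_real (norm \<theta> ^ 3)))"
proof -
  interpret determinantal_point_process M Z upper_half_plane K_H by (rule assms(1))
  note a = assms(2)
  obtain g where
    g: "\<And>L. L > 0 \<Longrightarrow> is_log_branch (\<lambda>\<theta>. expectation (\<lambda>\<omega>. exp (\<theta> * of_nat (count_N Z a L \<omega>)))) (g L)" and
    lim: "uniform_limit (cball 0 1) (\<lambda>L \<theta>. 2 * g L \<theta> - g (2 * L) \<theta>) C at_top"
    using szego_correction_eq_limit[OF assms(3)] by blast
  have ball: "ball 0 1 \<subseteq> strip pi"
    using cball_subset_strip[of 1 pi] pi_gt3 ball_subset_cball by force
  have g_hol: "g L holomorphic_on ball 0 1" if "L > 0" for L
    using g[OF that] ball holomorphic_on_subset unfolding is_log_branch_def by blast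
  have g_0: "g L 0 = 0" if "L > 0" for L using g[OF that] by (simp add: is_log_branch_def)
  note cumulants = cumulants_of_log_mgf[OF measurable_count_N[OF refl] g]
  note moments = mean_variance_count_N[OF assms(1) a _ cumulants(1,2)]
  define c where "c = (1 - 1 / a) / (4 * pi)"
  have g_1: "deriv (g L) 0 = of_real (L * c)" if "L > 0" for L
    using cumulants(3)[OF that] moments(1)[OF that that that] by (simp add: c_def)
  have g_2: "(deriv ^^ 2) (g L) 0 = of_real (L * c - int_K_sq a L / pi\<^sup>2)" if "L > 0" for L
    using cumulants(4)[OF that] moments(2)[OF that that that] by (simp add: c_def)

  define d where "d = (\<lambda>L \<theta>. 2 * g L \<theta> - g (2 * L) \<theta>)"
  have d_deriv: "(deriv ^^ k) (d L) 0 = 2 * (deriv ^^ k) (g L) 0 - (deriv ^^ k) (g (2 * L)) 0"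
    if "L > 0" for k L
  proof -
    have "(deriv ^^ k) (d L) 0 = (deriv ^^ k) (\<lambda>\<theta>. 2 * g L \<theta>) 0 - (deriv ^^ k) (g (2 * L)) 0"
      unfolding d_def using g_hol[of L] g_hol[of "2 * L"] that
      by (intro higher_deriv_diff[of _ "ball 0 1"] holomorphic_intros) auto
    also have "(deriv ^^ k) (\<lambda>\<theta>. 2 * g L \<theta>) 0 = 2 * (deriv ^^ k) (g L) 0"
      using g_hol[OF that] by (intro higher_deriv_cmult[of _ "ball 0 1"]) auto
    finally show ?thesis .
  qed
  have d_lim: "((\<lambda>L. (deriv ^^ k) (d L) 0) \<longlongrightarrow> (deriv ^^ k) C 0) at_top" for k
  proof (rule higher_deriv_complex_uniform_limit)
    show "uniform_limit (ball 0 1) d C at_top"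
      unfolding d_def by (rule uniform_limit_on_subset[OF lim ball_subset_cball])
    show "eventually (\<lambda>L. d L holomorphic_on ball 0 1) at_top"
      using eventually_gt_at_top[of 0]
      by eventually_elim (auto simp: d_def intro!: holomorphic_intros g_hol)
  qed auto
  have pos: "eventually (\<lambda>L :: real. L > 0) at_top" by (rule eventually_gt_at_top)
  have eqI: "(deriv ^^ k) C 0 = l"
    if "((\<lambda>L. 2 * (deriv ^^ k) (g L) 0 - (deriv ^^ k) (g (2 * L)) 0) \<longlongrightarrow> l) at_top" for k l
  proof (rule tendsto_unique[OF _ d_lim])
    show "((\<lambda>L. (deriv ^^ k) (d L) 0) \<longlongrightarrow> l) at_top"
      using that by (rule Lim_transform_eventually) (rule eventually_mono[OF pos], simp add: d_deriv)
  qed simp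

  have C0: "C 0 = 0"
    using eqI[of 0 0] by (simp add: tendsto_eventually eventually_mono[OF pos] g_0)
  have C1: "deriv C 0 = 0"
    using eqI[of 1 0] by (simp add: tendsto_eventually eventually_mono[OF pos] g_1)
  have C2: "(deriv ^^ 2) C 0 = of_real (1 / pi\<^sup>2 * ln ((a + 1)\<^sup>2 / (4 * a)))"
  proof (rule eqI)
    have "((\<lambda>L. complex_of_real (1 / pi\<^sup>2 * (int_K_sq a (2 * L) - 2 * int_K_sq a L)))
        \<longlongrightarrow> of_real (1 / pi\<^sup>2 * ln ((a + 1)\<^sup>2 / (4 * a)))) at_top"
      by (intro tendsto_of_real tendsto_mult tendsto_const int_K_sq_doubling_limit[OF a])
    moreover have "eventually (\<lambda>L. complex_of_real (1 / pi\<^sup>2 * (int_K_sq a (2 * L) - 2 * int_K_sq a L))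
        = 2 * (deriv ^^ 2) (g L) 0 - (deriv ^^ 2) (g (2 * L)) 0) at_top"
      using pos
    proof eventually_elim
      case (elim L)
      then have "2 * (deriv ^^ 2) (g L) 0 - (deriv ^^ 2) (g (2 * L)) 0
          = of_real (2 * (L * c - int_K_sq a L / pi\<^sup>2) - (2 * L * c - int_K_sq a (2 * L) / pi\<^sup>2))"
        by (simp add: g_2)
      also have "2 * (L * c - int_K_sq a L / pi\<^sup>2) - (2 * L * c - int_K_sq a (2 * L) / pi\<^sup>2)
          = 1 / pi\<^sup>2 * (int_K_sq a (2 * L) - 2 * int_K_sq a L)"
        by (simp add: algebra_simps diff_divide_distrib)
      finally show ?case by (rule sym)
    qed
    ultimately show "((\<lambda>L. 2 * (deriv ^^ 2) (g L) 0 - (deriv ^^ 2) (g (2 * L)) 0)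
        \<longlongrightarrow> of_real (1 / pi\<^sup>2 * ln ((a + 1)\<^sup>2 / (4 * a)))) at_top"
      by (rule Lim_transform_eventually)
  qed

  have "(\<lambda>\<theta>. C \<theta> - complex_of_real (1 / (2 * pi\<^sup>2) * ln ((a + 1)\<^sup>2 / (4 * a))) * \<theta>\<^sup>2)
      \<in> O[at 0 within T](\<lambda>\<theta>. complex_of_real (norm \<theta> ^ 3))" for T
  proof -
    have "C holomorphic_on strip pi" using assms(3) by (simp add: is_szego_correction_def)
    moreover have "0 \<in> strip pi" by (simp add: strip_def)
    ultimately have "(\<lambda>\<theta>. C \<theta> - (deriv ^^ 2) C 0 / 2 * \<theta>\<^sup>2)
        \<in> O[at 0 within T](\<lambda>\<theta>. complex_of_real (norm \<theta> ^ 3))"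
      by (intro cubic_remainder_bigo[OF _ open_strip] C0 C1)
    moreover have "(deriv ^^ 2) C 0 / 2 = complex_of_real (1 / (2 * pi\<^sup>2) * ln ((a + 1)\<^sup>2 / (4 * a)))"
      unfolding C2 by simp
    ultimately show ?thesis by simp
  qed
  with C0 C1 C2 show ?thesis by blast
qed

end
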